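(* Let $d\ge 2$. For every $c>0$ there exists a constant $\delta=\delta(c)>0$ such that asymptotically almost surely (as $n\to\infty$) every minimal core subcomplex $K$ of $Y\in Y_d(n,\frac{c}{n})$ with $f_d(K)\le \delta n^d$ contains the boundary of a $(d+1)$-simplex.
   Context: $\Delta_{n-1}$ denotes the $(n-1)$-dimensional simplex on vertex set $[n]$. $Y_d(n,p)$ is the probability space of complexes $\Delta_{n-1}^{(d-1)}\subset Y\subset\Delta_{n-1}^{(d)}$ in which each $d$-simplex is included independently with probability $p$. Here a subcomplex $K$ of $Y$ is determined by a set of $d$-simplices of $Y$ (its $d$-simplices), and consists of these $d$-simplices together with all their faces; $f_d(K)$ is its number of $d$-simplices. Such a complex is a core if every $(d-1)$-face of it is contained in at least two of its $d$-simplices. A core is a minimal core if none of its proper subcomplexes (in the same sense, with nonempty set of $d$-simplices) is a core. *)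

theory Defs
  imports Complex_Main
begin

definition dsimplices :: "nat \<Rightarrow> nat \<Rightarrow> nat set set" where
  "dsimplices n d = {\<sigma>. \<sigma> \<subseteq> {..<n} \<and> card \<sigma> = d + 1}"

text \<open>Probability in Y_d(n,p) of the event E. A complex Y is identified with
  its set S of d-simplices (the full (d-1)-skeleton is always present);
  each d-simplex is included independently with probability p.\<close>
definition Yprob :: "nat \<Rightarrow> nat \<Rightarrow> real \<Rightarrow> (nat set set \<Rightarrow> bool) \<Rightarrow> real" where
  "Yprob n d p E =
     (\<Sum>S\<in>{S. S \<subseteq> dsimplices n d \<and> E S}.
        p ^ card S * (1 - p) ^ (card (dsimplices n d) - card S))"

definition is_core :: "nat \<Rightarrow> nat set set \<Rightarrow> bool" where
  "is_core d T \<longleftrightarrow>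
     (\<forall>\<sigma>\<in>T. \<forall>\<tau>. \<tau> \<subseteq> \<sigma> \<and> card \<tau> = d \<longrightarrow> card {\<sigma>'\<in>T. \<tau> \<subseteq> \<sigma>'} \<ge> 2)"

definition minimal_core :: "nat \<Rightarrow> nat set set \<Rightarrow> bool" where
  "minimal_core d T \<longleftrightarrow> T \<noteq> {} \<and> is_core d T \<and>
     (\<forall>T'. T' \<subset> T \<and> T' \<noteq> {} \<longrightarrow> \<not> is_core d T')"

definition contains_boundary :: "nat \<Rightarrow> nat set set \<Rightarrow> bool" where
  "contains_boundary d T \<longleftrightarrow>
     (\<exists>\<rho>::nat set. finite \<rho> \<and> card \<rho> = d + 2 \<and> {\<sigma>. \<sigma> \<subseteq> \<rho> \<and> card \<sigma> = d + 1} \<subseteq> T)"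

end

theory Submission
  imports Defs
begin

text \<open>
  First moment over minimal cores \<open>T\<close> with \<open>m\<close> simplices. The dual graph of \<open>T\<close> (simplices sharing a
  \<open>(d - 1)\<close>-face) is connected with minimum degree at least 3, hence has a connected dominating set
  missing a positive fraction of \<open>T\<close>; as every face lies in two simplices, one can therefore delete
  a set \<open>R\<close> of \<open>r\<close> simplices, \<open>r\<close> proportional to \<open>m\<close>, so that \<open>A = T - R\<close> is still connected and still
  contains all faces of \<open>T\<close>. The weights \<open>p ^ card A\<close> of connected sets sum to at most
  \<open>n ^ (d + 1) * C ^ m\<close>. The simplices of \<open>R\<close> have all their faces among the \<open>O(m)\<close> faces of \<open>A\<close>, and by a
  Kruskal--Katona type bound there are only \<open>O(m powr (1 + 1 / d)) \<le> O(\<delta> powr (1 / d) * n * m)\<close> such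
  simplices, so the choices of \<open>R\<close> contribute an arbitrarily small constant to the power \<open>r\<close>. This
  settles all \<open>m\<close> except bounded ones, where it suffices that a core without the boundary of a simplex
  has fewer vertices than simplices.
\<close>

section \<open>Families of sets with a small shadow\<close>

lemma sum_card_containing:
  assumes "finite U" "finite X" "\<Union>X \<subseteq> U"
  shows "(\<Sum>v\<in>U. card {\<sigma>\<in>X. v \<in> \<sigma>}) = (\<Sum>\<sigma>\<in>X. card \<sigma>)"
proof -
  have "(\<Sum>v\<in>U. card {\<sigma>\<in>X. v \<in> \<sigma>}) = (\<Sum>\<sigma>\<in>X. card {v\<in>U. v \<in> \<sigma>})"
    using sum_multicount_gen[OF assms(1,2), of "\<lambda>v \<sigma>. v \<in> \<sigma>" "\<lambda>\<sigma>. card {v\<in>U. v \<in> \<sigma>}"] by simp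
  also have "\<dots> = (\<Sum>\<sigma>\<in>X. card \<sigma>)"
    using assms(3) by (intro sum.cong refl arg_cong[where f=card]) auto
  finally show ?thesis .
qed

lemma card_link:
  "card ((\<lambda>\<sigma>. \<sigma> - {v}) ` {\<sigma>\<in>X. v \<in> \<sigma>}) = card {\<sigma>\<in>X. v \<in> \<sigma>}"
  by (rule card_image) (auto simp: inj_on_def)

text \<open>A Kruskal-Katona type estimate, by induction on \<open>k\<close> through vertex links.
  In the step to \<open>Suc k\<close>, once every link satisfies
  \<open>card (Xv v) <= y * card (Ev v)\<close>, double counting over the vertices gives
  \<open>(k + 2) * card X <= y * (k + 1) * card E\<close>.\<close>

lemma card_le_shadow:
  fixes X E :: "'a set set" and y :: real
  assumes "finite X" "finite E" "k \<ge> 1" "0 \<le> y" "real (card E) \<le> y ^ k"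
    and "\<And>\<sigma>. \<sigma> \<in> X \<Longrightarrow> card \<sigma> = Suc k"
    and "\<And>\<tau>. \<tau> \<in> E \<Longrightarrow> finite \<tau> \<and> card \<tau> = k"
    and "\<And>\<sigma> x. \<sigma> \<in> X \<Longrightarrow> x \<in> \<sigma> \<Longrightarrow> \<sigma> - {x} \<in> E"
  shows "real (card X) \<le> real (card E) * y"
  using assms
proof (induction k arbitrary: X E)
  case (Suc k)
  define U where "U = \<Union>X \<union> \<Union>E"
  have fX: "finite \<sigma>" if "\<sigma> \<in> X" for \<sigma> using Suc.prems(6)[OF that] card.infinite by fastforce
  have U: "finite U" unfolding U_def using Suc.prems(1,2,7) fX by auto
  define Xv where "Xv = (\<lambda>v. (\<lambda>\<sigma>. \<sigma> - {v}) ` {\<sigma>\<in>X. v \<in> \<sigma>})"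
  define Ev where "Ev = (\<lambda>v. (\<lambda>\<sigma>. \<sigma> - {v}) ` {\<sigma>\<in>E. v \<in> \<sigma>})"
  have link: "real (card (Xv v)) \<le> y * real (card (Ev v))" for v
  proof (cases "Xv v = {}")
    case True then show ?thesis using Suc.prems(4) by simp
  next
    case False
    have fin: "finite (Xv v)" "finite (Ev v)" using Suc.prems(1,2) by (auto simp: Xv_def Ev_def)
    have face: "\<sigma> - {x} \<in> Ev v" if "\<sigma> \<in> Xv v" "x \<in> \<sigma>" for \<sigma> x
    proof -
      from that obtain s where s: "s \<in> X" "v \<in> s" "\<sigma> = s - {v}" by (auto simp: Xv_def)
      then have "s - {x} \<in> E" "v \<in> s - {x}" using Suc.prems(8) that by auto
      moreover have "\<sigma> - {x} = (s - {x}) - {v}" using s by auto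
      ultimately show ?thesis by (auto simp: Ev_def)
    qed
    have cX: "card \<sigma> = Suc k" if "\<sigma> \<in> Xv v" for \<sigma>
      using that Suc.prems(6) by (auto simp: Xv_def)
    have cE: "finite \<tau> \<and> card \<tau> = k" if "\<tau> \<in> Ev v" for \<tau>
      using that Suc.prems(7) by (fastforce simp: Ev_def)
    show ?thesis
    \<comment> \<open>A small link falls under the induction hypothesis. A large one has
      \<open>y ^ k <= card (Ev v)\<close>, and then the crude bound
      \<open>card (Xv v) <= card E <= y ^ Suc k\<close> suffices. The value \<open>k = 0\<close>
      joins this case because a nonempty \<open>Xv v\<close> makes \<open>Ev v\<close>
      nonempty.\<close>
    proof (cases "k \<ge> 1 \<and> real (card (Ev v)) \<le> y ^ k")
      case True
      then show ?thesis
        using Suc.IH[OF fin _ Suc.prems(4) _ cX cE face] by (simp add: mult.commute)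
    next
      case less: False
      have "y ^ k \<le> real (card (Ev v))"
      proof (cases "k \<ge> 1")
        case True with less show ?thesis by simp
      next
        case k0: False
        from False obtain \<sigma> where \<sigma>: "\<sigma> \<in> Xv v" by auto
        with cX have "\<sigma> \<noteq> {}" by fastforce
        with \<sigma> face have "Ev v \<noteq> {}" by blast
        with fin have "card (Ev v) > 0" by (simp add: card_gt_0_iff)
        moreover from k0 have "k = 0" by simp
        ultimately show ?thesis by simp
      qed
      have "Xv v \<subseteq> E" using Suc.prems(8) by (auto simp: Xv_def)
      then have "real (card (Xv v)) \<le> y ^ Suc k"
        using card_mono[OF Suc.prems(2)] Suc.prems(5) by (meson of_nat_mono order_trans)
      also have "\<dots> = y * y ^ k" by simp
      also have "\<dots> \<le> y * real (card (Ev v))"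
        by (intro mult_left_mono) (use \<open>y ^ k \<le> _\<close> Suc.prems(4) in auto)
      finally show ?thesis .
    qed
  qed
  have sX: "(\<Sum>v\<in>U. card (Xv v)) = (k + 2) * card X"
    unfolding Xv_def card_link using sum_card_containing[OF U Suc.prems(1)] Suc.prems(6)
    by (simp add: U_def)
  have sE: "(\<Sum>v\<in>U. card (Ev v)) = (k + 1) * card E"
    unfolding Ev_def card_link using sum_card_containing[OF U Suc.prems(2)] Suc.prems(7)
    by (simp add: U_def)
  have "real ((k + 2) * card X) = (\<Sum>v\<in>U. real (card (Xv v)))"
    unfolding sX[symmetric] by simp
  also have "\<dots> \<le> (\<Sum>v\<in>U. y * real (card (Ev v)))" by (intro sum_mono link)
  also have "\<dots> = y * real ((k + 1) * card E)"
    unfolding sE[symmetric] by (simp add: sum_distrib_left)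
  also have "\<dots> \<le> y * real ((k + 2) * card E)"
    by (intro mult_left_mono of_nat_mono) (use Suc.prems(4) in auto)
  also have "\<dots> = real (k + 2) * (real (card E) * y)"
    by (simp only: of_nat_mult) (simp only: ac_simps)
  finally have "real (k + 2) * real (card X) \<le> real (k + 2) * (real (card E) * y)"
    by (simp only: of_nat_mult)
  then show ?case by (rule mult_left_le_imp_le) simp
qed simp

section \<open>Connected dominating sets\<close>

text \<open>Connectivity as a cut condition, which avoids paths. The empty set satisfies it, so
  nonemptiness is required separately where it matters.\<close>

definition conn :: "('a \<Rightarrow> 'a \<Rightarrow> bool) \<Rightarrow> 'a set \<Rightarrow> bool" where
  "conn adj A \<longleftrightarrow> (\<forall>B. B \<noteq> {} \<and> B \<subset> A \<longrightarrow> (\<exists>x\<in>B. \<exists>y\<in>A - B. adj x y))"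

text \<open>A cut \<open>B\<close> of \<open>A'\<close> either splits \<open>A\<close>, and
  connectivity of \<open>A\<close> gives the edge, or it misses \<open>A\<close> or contains
  \<open>A\<close>, and domination gives it.\<close>

lemma conn_superset:
  assumes sym: "symp adj" and "conn adj A" "A \<noteq> {}" "A \<subseteq> A'"
    and dom: "\<And>x. x \<in> A' - A \<Longrightarrow> \<exists>y\<in>A. adj x y"
  shows "conn adj A'"
  unfolding conn_def
proof (intro allI impI)
  fix B assume B: "B \<noteq> {} \<and> B \<subset> A'"
  consider "A \<inter> B = {}" | "A \<subseteq> B" | "A \<inter> B \<noteq> {}" "\<not> A \<subseteq> B" by blast
  then show "\<exists>x\<in>B. \<exists>y\<in>A' - B. adj x y"
  proof cases
    case 1
    then show ?thesis using B dom assms(4) by blast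
  next
    case 2
    then obtain x where x: "x \<in> A' - B" using B by blast
    with 2 dom[of x] obtain y where "y \<in> A" "adj x y" by blast
    with x 2 sym show ?thesis by (meson sympD subsetD)
  next
    case 3
    then have "A \<inter> B \<subset> A" by blast
    with 3 assms(2) obtain x y where "x \<in> A \<inter> B" "y \<in> A - (A \<inter> B)" "adj x y"
      unfolding conn_def by meson
    then show ?thesis using assms(4) by blast
  qed
qed

lemma conn_insert:
  assumes "symp adj" "conn adj A" "x \<in> A" "adj x u"
  shows "conn adj (insert u A)"
  by (rule conn_superset[OF assms(1,2)]) (use assms sympD in fastforce)+

text \<open>Grow a connected set \<open>A\<close>, writing \<open>N\<close> for its closed neighbourhood. A leaf, i.e. an element
  of \<open>N - A\<close>, is dead if it has no neighbour outside \<open>N\<close>; dead leaves stay dead. The inequality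
  \<open>|A| \<le> 2 |N - A| + |dead| + 1\<close> can be maintained until \<open>N\<close> is everything, when all leaves are dead.\<close>

lemma ex_conn_dominating:
  fixes adj :: "'a \<Rightarrow> 'a \<Rightarrow> bool"
  assumes sym: "symp adj" and irr: "\<And>x. \<not> adj x x"
    and fin: "finite V" and ne: "V \<noteq> {}" and con: "conn adj V"
    and deg: "\<And>x. x \<in> V \<Longrightarrow> card {y\<in>V. adj x y} \<ge> 3"
  obtains A where "A \<subseteq> V" "A \<noteq> {}" "conn adj A" "\<forall>x\<in>V - A. \<exists>y\<in>A. adj x y"
    "card V \<le> 4 * card (V - A) + 1"
proof -
  define nb where "nb = (\<lambda>x. {y\<in>V. adj x y})"
  define N where "N = (\<lambda>A. A \<union> \<Union>(nb ` A))"
  define D where "D = (\<lambda>A. {x \<in> N A - A. nb x \<subseteq> N A})"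
  define P where "P = (\<lambda>A. A \<subseteq> V \<and> A \<noteq> {} \<and> conn adj A \<and>
      card A \<le> 2 * card (N A - A) + card (D A) + 1)"
  have nbV: "nb x \<subseteq> V" for x by (auto simp: nb_def)
  have NV: "N A \<subseteq> V" if "A \<subseteq> V" for A using that nbV by (auto simp: N_def)
  have nbsym: "y \<in> nb x \<longleftrightarrow> x \<in> nb y" if "x \<in> V" "y \<in> V" for x y
    using that sym by (auto simp: nb_def dest: sympD)
  have mono: "N A \<subseteq> N A'" if "A \<subseteq> A'" for A A' using that by (auto simp: N_def)
  have finN: "finite (N A)" if "A \<subseteq> V" for A using NV[OF that] fin finite_subset by blast
  obtain v where v: "v \<in> V" using ne by blast
  have "P {v}" using v by (auto simp: P_def conn_def)
  moreover have "\<forall>A. P A \<longrightarrow> card A \<le> card V" using fin by (auto simp: P_def card_mono)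
  \<comment> \<open>A largest \<open>A\<close> with \<open>P\<close> replaces the growth process:
    \<open>extend\<close> below turns every enlargement that preserves \<open>P\<close> into a
    contradiction.\<close>
  ultimately obtain A where A: "P A" and max: "\<And>B. P B \<Longrightarrow> card B \<le> card A"
    using ex_has_greatest_nat[of P "{v}" card "Suc (card V)"] by (metis less_Suc_eq_le)
  have AV: "A \<subseteq> V" and Ane: "A \<noteq> {}" and Ac: "conn adj A"
    and Acard: "card A \<le> 2 * card (N A - A) + card (D A) + 1" using A by (auto simp: P_def)
  have finA: "finite A" using AV fin finite_subset by blast
  have extend: False if "u \<in> N A - A" "P (insert u B)" "A \<subseteq> B" "finite B" for u B
  proof -
    have "card A < card (insert u B)"
      by (rule psubset_card_mono) (use that in auto)
    with max[OF that(2)] show False by simp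
  qed
  have cinsert: "conn adj (insert u A)" if u: "u \<in> N A - A" for u
  proof -
    from u obtain x where "x \<in> A" "adj x u" by (auto simp: N_def nb_def)
    then show ?thesis by (rule conn_insert[OF sym Ac])
  qed
  have outer: "w \<in> N (insert u A) - insert u A" if "u \<in> N A - A" "w \<in> nb u - N A" for u w
    using that irr by (auto simp: N_def nb_def)
  have dead_mono: "D A \<subseteq> D (insert u A)" if "u \<in> N A - A" "\<not> nb u \<subseteq> N A" for u
  proof
    fix x assume x: "x \<in> D A"
    then have "x \<noteq> u" using that(2) by (auto simp: D_def)
    then show "x \<in> D (insert u A)" using x mono[of A "insert u A"] by (auto simp: D_def)
  qed
  have Nins: "N (insert u A) = N A \<union> nb u" if "u \<in> N A" for u
    using that by (auto simp: N_def)
  have NA: "N A = V"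
  proof (rule ccontr)
    assume "N A \<noteq> V"
    then have "N A \<subset> V" using NV[OF AV] by blast
    moreover have "N A \<noteq> {}" using Ane by (auto simp: N_def)
    ultimately obtain u w where uw: "u \<in> N A" "w \<in> V - N A" "adj u w"
      using con unfolding conn_def by blast
    have uA: "u \<in> N A - A" using uw by (auto simp: N_def nb_def)
    have uV: "u \<in> V" using uA NV[OF AV] by blast
    have wu: "w \<in> nb u - N A" using uw by (auto simp: nb_def)
    \<comment> \<open>By maximality a leaf has at most one neighbour outside \<open>N A\<close>:
      absorbing a leaf with two of them raises \<open>card A\<close> by one but also gains a leaf,
      which counts twice.\<close>
    have one: "nb u' - N A = {w'}" if leaf: "u' \<in> N A - A" "w' \<in> nb u' - N A" for u' w'
    proof (rule ccontr)
      assume ne: "nb u' - N A \<noteq> {w'}"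
      then obtain w2 where w2: "w2 \<in> nb u' - N A" "w2 \<noteq> w'" using leaf(2) by blast
      have u'V: "u' \<in> V" using leaf(1) NV[OF AV] by blast
      have iV: "insert u' A \<subseteq> V" using u'V AV by auto
      have sub: "insert w' (insert w2 (N A - A - {u'})) \<subseteq> N (insert u' A) - insert u' A"
        using outer[OF leaf] outer[OF leaf(1) w2(1)] mono[of A "insert u' A"] by auto
      have "Suc (Suc (card (N A - A - {u'}))) \<le> card (N (insert u' A) - insert u' A)"
        using card_mono[OF _ sub] finN[OF iV] finN[OF AV] leaf(2) w2 by simp
      then have "card (N A - A) + 1 \<le> card (N (insert u' A) - insert u' A)"
        using leaf(1) finN[OF AV] card_Suc_Diff1[of "N A - A" u'] by simp
      moreover have "card (D A) \<le> card (D (insert u' A))"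
        using dead_mono[of u'] leaf finN[OF iV]
        by (intro card_mono) (auto simp: D_def)
      moreover have "card (insert u' A) = Suc (card A)" using leaf(1) finA by simp
      ultimately have "P (insert u' A)" using Acard iV cinsert[OF leaf(1)] by (auto simp: P_def)
      then show False using extend[OF leaf(1)] finA by blast
    qed
    define B where "B = insert u A"
    have BV: "B \<subseteq> V" using uV AV by (auto simp: B_def)
    have cB: "card B = Suc (card A)" using uA finA by (simp add: B_def)
    have NB: "N B = insert w (N A)" using Nins[of u] one[OF uA wu] uA wu by (auto simp: B_def)
    have NBB: "N B - B = insert w (N A - A - {u})" 
      using NB uA wu by (auto simp: B_def N_def)
    \<comment> \<open>Absorbing \<open>u\<close> merely trades the leaf \<open>u\<close> for
      \<open>w\<close>, so the growth of \<open>card A\<close> has to be paid for by absorbing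
      \<open>w\<close> as well or by a newly dead leaf.\<close>
    have ell: "card (N B - B) = card (N A - A)"
      unfolding NBB using wu uA finN[OF AV] card_Suc_Diff1[of "N A - A" u] by simp
    have wV: "w \<in> V" using wu nbV by blast
    have wA: "w \<notin> A" using wu by (auto simp: N_def)
    have nbwA: "nb w \<inter> A = {}"
      using wu wV AV nbsym by (auto simp: N_def)
    have wB: "w \<in> N B - B" unfolding NBB by simp
    have dB: "D A \<subseteq> D B" unfolding B_def by (rule dead_mono) (use uA wu in auto)
    have finw: "finite (nb w)" using fin nbV finite_subset by blast
    show False
    proof (cases "card (nb w - N A) \<ge> 2")
      case True
      \<comment> \<open>With two fresh neighbours of \<open>w\<close>, absorbing both
        \<open>u\<close> and \<open>w\<close> costs 2 and gains at least one leaf, which is worth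
        2.\<close>
      define C where "C = insert w B"
      have CV: "C \<subseteq> V" using wV BV by (auto simp: C_def)
      have cC: "card C = card A + 2" using wB cB finA by (simp add: C_def B_def)
      have NC: "N C = insert w (N A) \<union> nb w" unfolding NB[symmetric] using wB by (auto simp: C_def N_def)
      have C1: "N C - C = (N A - A - {u}) \<union> (nb w - N A)"
      proof -
        have "A \<subseteq> N A" "w \<notin> nb w" "w \<notin> N A" using irr wu by (auto simp: N_def nb_def)
        then show ?thesis unfolding NC unfolding C_def B_def using uA nbwA by auto
      qed
      have "card (N C - C) = card (N A - A - {u}) + card (nb w - N A)"
        unfolding C1 by (rule card_Un_disjoint) (use finN[OF AV] finw in auto)
      then have "card (N C - C) \<ge> card (N A - A) + 1"
        using True card_Suc_Diff1[of "N A - A" u] uA finN[OF AV] by simp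
      moreover have "card (D A) \<le> card (D C)"
      proof (rule card_mono)
        show "finite (D C)" using finN[OF CV] by (auto simp: D_def)
        have "D A \<subseteq> N C - C" using dB unfolding C1 using dB by (auto simp: D_def B_def)
        then show "D A \<subseteq> D C" using mono[of A C] by (auto simp: D_def C_def B_def)
      qed
      moreover have "conn adj C"
        unfolding C_def B_def
        by (rule conn_insert[OF sym cinsert[OF uA], of u]) (use uw in auto)
      ultimately have "P C" using Acard CV cC by (auto simp: P_def C_def)
      then have "P (insert u (insert w A))" by (simp add: C_def B_def insert_commute)
      then show False using extend[OF uA] finA by blast
    next
      case False
      text \<open>Now \<open>w\<close> has a second neighbour \<open>u'\<close> among the leaves, and adding \<open>u\<close> makes \<open>u'\<close> dead.\<close>
      have "card (nb w) \<ge> 3" using deg[OF wV] by (simp add: nb_def)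
      moreover have "card (nb w) = card (nb w - N A) + card (nb w \<inter> N A)"
        using finw by (subst card_Un_disjoint[symmetric]) (auto intro: arg_cong[where f=card])
      ultimately have "card (nb w \<inter> N A) \<ge> 2" using False by linarith
      then have "\<not> nb w \<inter> N A \<subseteq> {u}"
        using card_mono[of "{u}" "nb w \<inter> N A"] by auto
      then obtain u' where u': "u' \<in> nb w" "u' \<in> N A" "u' \<noteq> u" by blast
      have u'A: "u' \<in> N A - A" using u' nbwA by blast
      have u'V: "u' \<in> V" using u' nbV by blast
      have "w \<in> nb u' - N A" using u' nbsym[OF u'V wV] wu by blast
      then have nbu': "nb u' - N A = {w}" by (rule one[OF u'A])
      then have "u' \<in> D B" using NB u' u'A NBB by (auto simp: D_def)
      moreover have "u' \<notin> D A" using nbu' by (auto simp: D_def)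
      ultimately have "D A \<subset> D B" using dB by blast
      then have "card (D A) < card (D B)"
        by (rule psubset_card_mono[rotated]) (use finN[OF BV] in \<open>auto simp: D_def\<close>)
      then have "P B" using Acard BV cB cinsert[OF uA] ell by (auto simp: P_def B_def)
      then show False using extend[OF uA, of A] finA by (simp add: B_def)
    qed
  qed
  \<comment> \<open>Once \<open>N A = V\<close>, at most \<open>card (V - A)\<close> leaves are
    dead, so the invariant reads \<open>card A <= 3 * card (V - A) + 1\<close>.\<close>
  have "D A \<subseteq> N A - A" by (auto simp: D_def)
  then have "card (D A) \<le> card (V - A)" using NA fin by (metis card_mono finite_Diff)
  then have "card A \<le> 3 * card (V - A) + 1" using Acard NA by simp
  moreover have "card V = card A + card (V - A)"
    using AV fin by (metis card_mono card_Diff_subset finA le_add_diff_inverse)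
  ultimately have "card V \<le> 4 * card (V - A) + 1" by linarith
  moreover have "\<exists>y\<in>A. adj x y" if "x \<in> V - A" for x
    using that NA sym by (auto simp: N_def nb_def dest: sympD)
  ultimately show thesis using that AV Ane Ac by blast
qed

section \<open>Weights of connected sets\<close>

text \<open>The probability that a random \<open>S\<close> contains \<open>A\<close> and misses
  \<open>B\<close>: the elements of \<open>V - A - B\<close> are unconstrained and contribute the
  product of the factors \<open>p + (1 - p) = 1\<close>.\<close>

lemma sum_bernoulli_between:
  fixes p :: real
  assumes "finite V" "A \<subseteq> V" "B \<subseteq> V" "A \<inter> B = {}"
  shows "(\<Sum>S | A \<subseteq> S \<and> S \<subseteq> V \<and> S \<inter> B = {}. p ^ card S * (1 - p) ^ (card V - card S)) =
         p ^ card A * (1 - p) ^ card B"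
proof -
  let ?W = "V - A - B"
  have fin: "finite A" "finite B" "finite ?W" using assms finite_subset by auto
  have "card V = card (A \<union> B \<union> ?W)" using assms by (intro arg_cong[where f=card]) auto
  also have "\<dots> = card A + card B + card ?W"
    using assms fin by (subst card_Un_disjoint; (subst card_Un_disjoint)?) auto
  finally have cV: "card V = card A + card B + card ?W" .
  have "(\<Sum>S | A \<subseteq> S \<and> S \<subseteq> V \<and> S \<inter> B = {}. p ^ card S * (1 - p) ^ (card V - card S)) =
        (\<Sum>X\<in>Pow ?W. p ^ card (A \<union> X) * (1 - p) ^ (card V - card (A \<union> X)))"
    by (rule sum.reindex_bij_witness[where i="\<lambda>X. A \<union> X" and j="\<lambda>S. S - A"])
       (use assms in \<open>auto simp: Un_absorb1 Un_Diff_cancel\<close>)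
  also have "\<dots> = (\<Sum>X\<in>Pow ?W. (p ^ card A * (1 - p) ^ card B) * (p ^ card X * (1 - p) ^ card (?W - X)))"
  proof (rule sum.cong[OF refl])
    fix X assume X: "X \<in> Pow ?W"
    then have "finite X" using fin finite_subset by blast
    moreover have "A \<inter> X = {}" using X by auto
    ultimately have 1: "card (A \<union> X) = card A + card X" using fin by (simp add: card_Un_disjoint)
    have "card ?W = card X + card (?W - X)"
      using X fin by (metis PowD card_Diff_subset card_mono \<open>finite X\<close> le_add_diff_inverse)
    then have "card V - card (A \<union> X) = card B + card (?W - X)" using cV 1 by simp
    then show "p ^ card (A \<union> X) * (1 - p) ^ (card V - card (A \<union> X)) =
        (p ^ card A * (1 - p) ^ card B) * (p ^ card X * (1 - p) ^ card (?W - X))"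
      by (simp add: 1 power_add)
  qed
  also have "\<dots> = (p ^ card A * (1 - p) ^ card B) * (\<Prod>x\<in>?W. p + (1 - p))"
    unfolding prod_add[OF fin(3)] by (simp add: sum_distrib_left[symmetric])
  finally show ?thesis by simp
qed

corollary sum_bernoulli_superset:
  fixes p :: real
  assumes "finite V" "A \<subseteq> V"
  shows "(\<Sum>S | A \<subseteq> S \<and> S \<subseteq> V. p ^ card S * (1 - p) ^ (card V - card S)) = p ^ card A"
  using sum_bernoulli_between[OF assms, of "{}" p] by simp

definition outer_boundary :: "('a \<Rightarrow> 'a \<Rightarrow> bool) \<Rightarrow> 'a set \<Rightarrow> 'a set \<Rightarrow> 'a set" where
  "outer_boundary adj V A = {y \<in> V - A. \<exists>x\<in>A. adj x y}"

text \<open>For a random \<open>S \<subseteq> V\<close>, the events \<open>A \<subseteq> S \<subseteq> V - outer_boundary adj V A\<close> say that \<open>A\<close> is the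
  component of \<open>v\<close> in \<open>S\<close>, so they are disjoint and their probabilities sum to at most 1.\<close>

lemma sum_conn_containing_le_1:
  fixes p :: real
  assumes fin: "finite V" and p: "0 \<le> p" "p \<le> 1"
    and F: "\<And>A. A \<in> F \<Longrightarrow> A \<subseteq> V \<and> conn adj A \<and> v \<in> A"
  shows "(\<Sum>A\<in>F. p ^ card A * (1 - p) ^ card (outer_boundary adj V A)) \<le> 1"
proof -
  let ?w = "\<lambda>S. p ^ card S * (1 - p) ^ (card V - card S)"
  define Q where "Q = (\<lambda>A. {S. A \<subseteq> S \<and> S \<subseteq> V \<and> S \<inter> outer_boundary adj V A = {}})"
  have finF: "finite F" by (rule finite_subset[of _ "Pow V"]) (use F fin in auto)
  \<comment> \<open>Were \<open>A1\<close> not inside \<open>A2\<close>, connectivity of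
    \<open>A1\<close> would give an edge from \<open>A2\<close> to an element of \<open>A1\<close>
    outside \<open>A2\<close>, which lies both in \<open>S\<close> and in the outer boundary of
    \<open>A2\<close>.\<close>
  have "A1 \<subseteq> A2" if A: "A1 \<in> F" "A2 \<in> F" "S \<in> Q A1" "S \<in> Q A2" for A1 A2 S
  proof (rule ccontr)
    assume "\<not> A1 \<subseteq> A2"
    then have "A1 \<inter> A2 \<noteq> {} \<and> A1 \<inter> A2 \<subset> A1" using F that by blast
    then obtain x y where "x \<in> A1 \<inter> A2" "y \<in> A1 - (A1 \<inter> A2)" "adj x y"
      using F[OF A(1)] unfolding conn_def by meson
    then have "y \<in> S \<inter> outer_boundary adj V A2"
      using that by (auto simp: Q_def outer_boundary_def)
    then show False using that(4) by (auto simp: Q_def)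
  qed
  then have disj: "Q A1 \<inter> Q A2 = {}" if "A1 \<in> F" "A2 \<in> F" "A1 \<noteq> A2" for A1 A2
    using that by (metis disjoint_iff equalityI)
  have finQ: "finite (Q A)" for A
    by (rule finite_subset[of _ "Pow V"]) (use fin in \<open>auto simp: Q_def\<close>)
  have "(\<Sum>A\<in>F. p ^ card A * (1 - p) ^ card (outer_boundary adj V A)) = (\<Sum>A\<in>F. sum ?w (Q A))"
    unfolding Q_def using F fin
    by (intro sum.cong refl sum_bernoulli_between[symmetric]) (auto simp: outer_boundary_def)
  also have "\<dots> = sum ?w (\<Union>A\<in>F. Q A)"
    by (rule sum.UNION_disjoint[symmetric]) (use finF finQ disj in auto)
  also have "\<dots> \<le> sum ?w (Pow V)"
    by (rule sum_mono2) (use fin p in \<open>auto simp: Q_def\<close>)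
  also have "\<dots> = 1"
    using sum_bernoulli_superset[OF fin, of "{}" p] by (simp add: Pow_def)
  finally show ?thesis .
qed

text \<open>Each connected \<open>A\<close> is counted at its elements \<open>v\<close>. A set of
  size \<open>a\<close> has at most \<open>D * a\<close> boundary elements, so passing from the
  disjoint events to \<open>p ^ a\<close> loses at most a factor \<open>(1 - p) ^ (D * a)\<close>;
  for \<open>p\<close> of order \<open>1 / D\<close> this is only exponential in
  \<open>a\<close>.\<close>

lemma sum_conn_card_le:
  fixes p :: real
  assumes fin: "finite V" and p: "0 \<le> p" "p < 1"
    and deg: "\<And>x. x \<in> V \<Longrightarrow> card {y\<in>V. adj x y} \<le> D"
  shows "(\<Sum>A | A \<subseteq> V \<and> conn adj A \<and> A \<noteq> {} \<and> card A = a. p ^ a)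
           \<le> real (card V) * (inverse (1 - p) ^ D) ^ a"
proof -
  define F where "F = (\<lambda>v. {A. A \<subseteq> V \<and> conn adj A \<and> v \<in> A \<and> card A = a})"
  have finF: "finite (F v)" for v
    by (rule finite_subset[of _ "Pow V"]) (use fin in \<open>auto simp: F_def\<close>)
  have one: "(\<Sum>A\<in>F v. p ^ a) \<le> (inverse (1 - p) ^ D) ^ a" for v
  proof -
    have "(\<Sum>A\<in>F v. p ^ a * (1 - p) ^ (D * a)) \<le>
          (\<Sum>A\<in>F v. p ^ card A * (1 - p) ^ card (outer_boundary adj V A))"
    proof (rule sum_mono)
      fix A assume A: "A \<in> F v"
      then have AV: "A \<subseteq> V" "finite A" using fin finite_subset by (auto simp: F_def)
      have "outer_boundary adj V A \<subseteq> (\<Union>x\<in>A. {y\<in>V. adj x y})"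
        by (auto simp: outer_boundary_def)
      then have "card (outer_boundary adj V A) \<le> card (\<Union>x\<in>A. {y\<in>V. adj x y})"
        by (rule card_mono[rotated]) (use AV fin in auto)
      also have "\<dots> \<le> (\<Sum>x\<in>A. card {y\<in>V. adj x y})" by (rule card_UN_le[OF AV(2)])
      also have "\<dots> \<le> (\<Sum>x\<in>A. D)" by (rule sum_mono) (use AV deg in auto)
      also have "\<dots> = D * a" using A by (simp add: F_def)
      finally show "p ^ a * (1 - p) ^ (D * a) \<le>
          p ^ card A * (1 - p) ^ card (outer_boundary adj V A)"
        using p A by (auto simp: F_def intro!: mult_left_mono power_decreasing)
    qed
    also have "\<dots> \<le> 1"
      by (rule sum_conn_containing_le_1[OF fin, of _ _ adj v]) (use p in \<open>auto simp: F_def\<close>)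
    finally have "(\<Sum>A\<in>F v. p ^ a) * (1 - p) ^ (D * a) \<le> 1" by (simp add: sum_distrib_right)
    then have "(\<Sum>A\<in>F v. p ^ a) \<le> inverse ((1 - p) ^ (D * a))"
      using p by (simp add: field_simps del: sum_constant)
    then show ?thesis by (simp add: power_mult power_inverse)
  qed
  have "{A. A \<subseteq> V \<and> conn adj A \<and> A \<noteq> {} \<and> card A = a} \<subseteq> (\<Union>v\<in>V. F v)"
    by (auto simp: F_def)
  then have "(\<Sum>A | A \<subseteq> V \<and> conn adj A \<and> A \<noteq> {} \<and> card A = a. p ^ a) \<le> (\<Sum>A\<in>(\<Union>v\<in>V. F v). p ^ a)"
    by (rule sum_mono2[rotated]) (use fin finF p in auto)
  also have "\<dots> = real (card (\<Union>v\<in>V. F v)) * p ^ a" by simp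
  also have "\<dots> \<le> real (\<Sum>v\<in>V. card (F v)) * p ^ a"
    by (intro mult_right_mono of_nat_mono card_UN_le) (use fin p in auto)
  also have "\<dots> = (\<Sum>v\<in>V. \<Sum>A\<in>F v. p ^ a)" by (simp add: sum_distrib_right)
  also have "\<dots> \<le> (\<Sum>v\<in>V. (inverse (1 - p) ^ D) ^ a)" by (rule sum_mono[OF one])
  also have "\<dots> = real (card V) * (inverse (1 - p) ^ D) ^ a" by simp
  finally show ?thesis .
qed

section \<open>Removing simplices from a minimal core\<close>

definition adjacent :: "nat \<Rightarrow> nat set \<Rightarrow> nat set \<Rightarrow> bool" where
  "adjacent d \<sigma> \<sigma>' \<longleftrightarrow> \<sigma> \<noteq> \<sigma>' \<and> (\<exists>\<tau>. card \<tau> = d \<and> \<tau> \<subseteq> \<sigma> \<and> \<tau> \<subseteq> \<sigma>')"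

definition faces :: "nat \<Rightarrow> nat set set \<Rightarrow> nat set set" where
  "faces d T = {\<tau>. card \<tau> = d \<and> (\<exists>\<sigma>\<in>T. \<tau> \<subseteq> \<sigma>)}"

lemma symp_adjacent: "symp (adjacent d)"
  by (auto simp: symp_def adjacent_def)

lemma finite_dsimplices [simp]: "finite (dsimplices n d)"
  by (rule finite_subset[of _ "Pow {..<n}"]) (auto simp: dsimplices_def)

lemma dsimplicesD:
  assumes "\<sigma> \<in> dsimplices n d"
  shows "finite \<sigma>" "card \<sigma> = d + 1" "\<sigma> \<subseteq> {..<n}"
  using assms finite_subset by (auto simp: dsimplices_def)

lemma card_dsimplices_le: "card (dsimplices n d) \<le> n ^ (d + 1)"
proof -
  have "card (dsimplices n d) = n choose (d + 1)"
    unfolding dsimplices_def by (subst n_subsets) simp_all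
  also have "\<dots> \<le> n ^ (d + 1)"
    using binomial_fact_pow[of n "d + 1"]
    by (metis fact_ge_1 le_trans mult.right_neutral mult_le_mono2)
  finally show ?thesis .
qed

lemma codim1_subset:
  assumes "card \<tau> = d" "\<tau> \<subseteq> \<sigma>" "finite \<sigma>" "card \<sigma> = d + 1"
  obtains x where "x \<in> \<sigma>" "\<tau> = \<sigma> - {x}"
proof -
  have "finite \<tau>" using assms finite_subset by blast
  then have "card (\<sigma> - \<tau>) = 1" using assms by (simp add: card_Diff_subset)
  then obtain x where "\<sigma> - \<tau> = {x}" by (metis card_1_singletonE)
  then show ?thesis using that[of x] assms(2) by blast
qed

text \<open>A neighbour is determined by the vertex removed from \<open>\<sigma>\<close> and the
  vertex put in its place.\<close>

lemma card_adjacent_le: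
  assumes "\<sigma> \<in> dsimplices n d"
  shows "card {\<sigma>' \<in> dsimplices n d. adjacent d \<sigma> \<sigma>'} \<le> (d + 1) * n"
proof -
  note \<sigma> = dsimplicesD[OF assms]
  have "{\<sigma>' \<in> dsimplices n d. adjacent d \<sigma> \<sigma>'} \<subseteq> (\<lambda>(x, v). insert v (\<sigma> - {x})) ` (\<sigma> \<times> {..<n})"
  proof
    fix \<sigma>' assume "\<sigma>' \<in> {\<sigma>' \<in> dsimplices n d. adjacent d \<sigma> \<sigma>'}"
    then obtain \<tau> where s: "\<sigma>' \<in> dsimplices n d" "card \<tau> = d" "\<tau> \<subseteq> \<sigma>" "\<tau> \<subseteq> \<sigma>'"
      by (auto simp: adjacent_def)
    obtain x where x: "x \<in> \<sigma>" "\<tau> = \<sigma> - {x}" using codim1_subset[OF s(2,3) \<sigma>(1,2)] .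
    obtain v where v: "v \<in> \<sigma>'" "\<tau> = \<sigma>' - {v}"
      using codim1_subset[OF s(2,4)] dsimplicesD[OF s(1)] by blast
    have "\<sigma>' = insert v (\<sigma> - {x})" using x v by blast
    moreover have "v < n" using v s(1) by (auto simp: dsimplices_def)
    ultimately show "\<sigma>' \<in> (\<lambda>(x, v). insert v (\<sigma> - {x})) ` (\<sigma> \<times> {..<n})"
      using x by (intro image_eqI[of _ _ "(x, v)"]) auto
  qed
  then have "card {\<sigma>' \<in> dsimplices n d. adjacent d \<sigma> \<sigma>'} \<le> card (\<sigma> \<times> {..<n})"
    using \<sigma>(1) by (meson card_image_le card_mono finite_SigmaI finite_imageI finite_lessThan le_trans)
  then show ?thesis using \<sigma> by (simp add: card_cartesian_product)
qed

lemma faces_finite: "d > 0 \<Longrightarrow> \<tau> \<in> faces d T \<Longrightarrow> finite \<tau> \<and> card \<tau> = d"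
  by (auto simp: faces_def intro: card_ge_0_finite)

lemma card_faces_le:
  assumes "T \<subseteq> dsimplices n d"
  shows "finite (faces d T)" "card (faces d T) \<le> (d + 1) * card T"
proof -
  have fT: "finite T" by (rule finite_subset[OF assms finite_dsimplices])
  have "faces d T \<subseteq> (\<Union>\<sigma>\<in>T. {\<tau>. \<tau> \<subseteq> \<sigma> \<and> card \<tau> = d})" by (auto simp: faces_def)
  moreover have fin: "finite (\<Union>\<sigma>\<in>T. {\<tau>. \<tau> \<subseteq> \<sigma> \<and> card \<tau> = d})"
    using fT assms dsimplicesD(1) by auto
  ultimately show "finite (faces d T)" using finite_subset by blast
  have "card (faces d T) \<le> card (\<Union>\<sigma>\<in>T. {\<tau>. \<tau> \<subseteq> \<sigma> \<and> card \<tau> = d})"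
    by (rule card_mono) fact+
  also have "\<dots> \<le> (\<Sum>\<sigma>\<in>T. card {\<tau>. \<tau> \<subseteq> \<sigma> \<and> card \<tau> = d})" by (rule card_UN_le[OF fT])
  also have "\<dots> = (\<Sum>\<sigma>\<in>T. d + 1)"
  proof (rule sum.cong[OF refl])
    fix \<sigma> assume "\<sigma> \<in> T"
    then have "finite \<sigma>" "card \<sigma> = d + 1" using assms dsimplicesD by blast+
    then show "card {\<tau>. \<tau> \<subseteq> \<sigma> \<and> card \<tau> = d} = d + 1" by (simp add: n_subsets)
  qed
  finally show "card (faces d T) \<le> (d + 1) * card T" by (simp add: mult.commute)
qed

lemma core_other:
  assumes "is_core d T" "\<sigma> \<in> T" "\<tau> \<subseteq> \<sigma>" "card \<tau> = d"
  obtains \<sigma>' where "\<sigma>' \<in> T" "\<sigma>' \<noteq> \<sigma>" "\<tau> \<subseteq> \<sigma>'"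
proof -
  have "card {\<sigma>'\<in>T. \<tau> \<subseteq> \<sigma>'} \<ge> 2" using assms by (auto simp: is_core_def)
  then have "\<not> {\<sigma>'\<in>T. \<tau> \<subseteq> \<sigma>'} \<subseteq> {\<sigma>}" using card_mono[of "{\<sigma>}" "{\<sigma>'\<in>T. \<tau> \<subseteq> \<sigma>'}"] by auto
  then show ?thesis using that by blast
qed

text \<open>Every face \<open>\<sigma> - {x}\<close> leads to another simplex. Two distinct faces of
  \<open>\<sigma>\<close> have union \<open>\<sigma>\<close>, so no other simplex contains both;
  hence injectivity.\<close>

lemma core_neighbours:
  assumes "is_core d T" "T \<subseteq> dsimplices n d" "\<sigma> \<in> T"
  obtains g where "inj_on g \<sigma>"
    "\<And>x. x \<in> \<sigma> \<Longrightarrow> g x \<in> T \<and> g x \<noteq> \<sigma> \<and> \<sigma> - {x} \<subseteq> g x"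
proof -
  note \<sigma> = dsimplicesD[OF subsetD[OF assms(2,3)]]
  have "\<forall>x\<in>\<sigma>. \<exists>s. s \<in> T \<and> s \<noteq> \<sigma> \<and> \<sigma> - {x} \<subseteq> s"
  proof
    fix x assume "x \<in> \<sigma>"
    then have "card (\<sigma> - {x}) = d" using \<sigma> by simp
    from core_other[OF assms(1,3) Diff_subset this] show "\<exists>s. s \<in> T \<and> s \<noteq> \<sigma> \<and> \<sigma> - {x} \<subseteq> s" by metis
  qed
  then obtain g where g: "\<And>x. x \<in> \<sigma> \<Longrightarrow> g x \<in> T \<and> g x \<noteq> \<sigma> \<and> \<sigma> - {x} \<subseteq> g x" by metis
  have "inj_on g \<sigma>"
  proof (rule inj_onI, rule ccontr)
    fix x y assume xy: "x \<in> \<sigma>" "y \<in> \<sigma>" "g x = g y" "x \<noteq> y"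
    then have "\<sigma> \<subseteq> g x" using g[of x] g[of y] by auto
    moreover have "finite (g x)" "card (g x) = card \<sigma>"
      using g[OF xy(1)] assms(2) dsimplicesD \<sigma>(2) by (metis subsetD)+
    ultimately show False using g[OF xy(1)] card_subset_eq by metis
  qed
  with g show ?thesis using that by blast
qed

text \<open>If no edge left \<open>B\<close>, every coface of a face of \<open>B\<close> would lie
  in \<open>B\<close>, and \<open>B\<close> would be a smaller core.\<close>

lemma minimal_core_conn:
  assumes "minimal_core d T"
  shows "conn (adjacent d) T"
  unfolding conn_def
proof (intro allI impI, rule ccontr)
  fix B assume B: "B \<noteq> {} \<and> B \<subset> T" and no: "\<not> (\<exists>x\<in>B. \<exists>y\<in>T - B. adjacent d x y)"
  have "is_core d B"
    unfolding is_core_def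
  proof (intro ballI allI impI)
    fix \<sigma> \<tau> assume *: "\<sigma> \<in> B" "\<tau> \<subseteq> \<sigma> \<and> card \<tau> = d"
    have "{\<sigma>'\<in>B. \<tau> \<subseteq> \<sigma>'} = {\<sigma>'\<in>T. \<tau> \<subseteq> \<sigma>'}"
    proof -
      have "\<sigma>' \<in> B" if "\<sigma>' \<in> T" "\<tau> \<subseteq> \<sigma>'" for \<sigma>'
      proof (rule ccontr)
        assume "\<sigma>' \<notin> B"
        then have "\<sigma> \<noteq> \<sigma>'" using *(1) by blast
        then have "adjacent d \<sigma> \<sigma>'" using *(2) that(2) by (auto simp: adjacent_def)
        then show False using no *(1) that(1) \<open>\<sigma>' \<notin> B\<close> by blast
      qed
      then show ?thesis using B by blast
    qed
    moreover have "is_core d T" "\<sigma> \<in> T" using assms * B by (auto simp: minimal_core_def)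
    ultimately show "2 \<le> card {\<sigma>'\<in>B. \<tau> \<subseteq> \<sigma>'}" using *(2) by (simp add: is_core_def)
  qed
  then show False using B assms unfolding minimal_core_def by blast
qed

text \<open>Take a maximal \<open>R' \<subseteq> R\<close> whose deletion from \<open>T\<close> keeps all faces covered. Each
  \<open>\<sigma> \<in> R - R'\<close> has a face \<open>\<tau>\<close> of which \<open>\<sigma>\<close> is the only coface outside \<open>R'\<close>, so \<open>\<sigma>\<close> is determined
  by \<open>\<tau>\<close> and \<open>\<tau>\<close> is a face of an element of \<open>R'\<close>.\<close>

lemma ex_removable_subset:
  assumes core: "is_core d T" and T: "T \<subseteq> dsimplices n d" and R: "R \<subseteq> T"
  obtains R' where "R' \<subseteq> R" "faces d T \<subseteq> faces d (T - R')" "card R \<le> (d + 2) * card R'"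
proof -
  have fT: "finite T" by (rule finite_subset[OF T finite_dsimplices])
  define P where "P = (\<lambda>R'. R' \<subseteq> R \<and> faces d T \<subseteq> faces d (T - R'))"
  have "P {}" by (simp add: P_def)
  moreover have "\<forall>A. P A \<longrightarrow> card A < Suc (card T)"
    using fT R card_mono[of T] by (auto simp: P_def less_Suc_eq_le)
  ultimately obtain R' where R': "P R'" and max: "\<And>B. P B \<Longrightarrow> card B \<le> card R'"
    using ex_has_greatest_nat[of P "{}" card "Suc (card T)"] by metis
  have R'T: "R' \<subseteq> R" "R' \<subseteq> dsimplices n d" and cov: "faces d T \<subseteq> faces d (T - R')"
    using R' R T by (auto simp: P_def)
  have finR: "finite R" "finite R'" using finite_subset[OF R fT] finite_subset[OF R'T(1)] by auto
  have "\<exists>\<tau>\<in>faces d R'. \<forall>s\<in>T - R'. \<tau> \<subseteq> s \<longleftrightarrow> s = \<sigma>" if \<sigma>: "\<sigma> \<in> R - R'" for \<sigma>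
  proof -
    have "card (insert \<sigma> R') = Suc (card R')" using \<sigma> finR by simp
    then have "\<not> P (insert \<sigma> R')" using max[of "insert \<sigma> R'"] by fastforce
    then obtain \<tau> where \<tau>: "\<tau> \<in> faces d T" "\<tau> \<notin> faces d (T - insert \<sigma> R')"
      using \<sigma> R'T(1) by (auto simp: P_def)
    then have "\<tau> \<in> faces d (T - R')" using cov by blast
    then obtain s where s: "s \<in> T - R'" "\<tau> \<subseteq> s" "card \<tau> = d" by (auto simp: faces_def)
    with \<tau> have "s = \<sigma>" by (auto simp: faces_def)
    with s have \<tau>\<sigma>: "\<tau> \<subseteq> \<sigma>" "\<sigma> \<in> T" by auto
    obtain \<sigma>' where "\<sigma>' \<in> T" "\<sigma>' \<noteq> \<sigma>" "\<tau> \<subseteq> \<sigma>'"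
      using core_other[OF core \<tau>\<sigma>(2,1) s(3)] .
    then have "\<tau> \<in> faces d R'" using \<tau> s(3) by (auto simp: faces_def)
    moreover have "\<forall>s\<in>T - R'. \<tau> \<subseteq> s \<longleftrightarrow> s = \<sigma>" using \<tau> \<tau>\<sigma> s(3) by (auto simp: faces_def)
    ultimately show ?thesis by blast
  qed
  then obtain h where h: "\<And>\<sigma>. \<sigma> \<in> R - R' \<Longrightarrow> h \<sigma> \<in> faces d R' \<and> (\<forall>s\<in>T - R'. h \<sigma> \<subseteq> s \<longleftrightarrow> s = \<sigma>)"
    by metis
  have "inj_on h (R - R')"
  proof (rule inj_onI)
    fix x y assume "x \<in> R - R'" "y \<in> R - R'" "h x = h y"
    then show "x = y" using h[of x] h[of y] R by blast
  qed
  then have "card (R - R') \<le> card (faces d R')"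
    using h card_faces_le(1)[OF R'T(2)] by (metis card_inj_on_le image_subsetI)
  also have "\<dots> \<le> (d + 1) * card R'" by (rule card_faces_le(2)[OF R'T(2)])
  finally have "card (R - R') \<le> (d + 1) * card R'" .
  moreover have "card R = card (R - R') + card R'"
    using R'T finR by (metis card_Diff_subset card_mono le_add_diff_inverse2)
  ultimately have "card R \<le> (d + 2) * card R'" by simp
  then show ?thesis using that R'T cov by blast
qed

text \<open>The factor 4 comes from the connected dominating set \<open>A0\<close>, the factor
  \<open>d + 2\<close> from passing to removable simplices outside it. Containing \<open>A0\<close>,
  the set \<open>A\<close> is again connected. The exact size \<open>r\<close> serves the later
  counting.\<close>

lemma ex_removable:
  assumes d: "d \<ge> 2" and T: "T \<subseteq> dsimplices n d" and mc: "minimal_core d T"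
    and r: "r = (card T - 1) div (4 * (d + 2))"
  obtains A where "A \<subseteq> T" "A \<noteq> {}" "conn (adjacent d) A" "faces d T \<subseteq> faces d A"
    "card (T - A) = r" "card A = card T - r"
proof -
  have core: "is_core d T" and ne: "T \<noteq> {}" using mc by (auto simp: minimal_core_def)
  have fT: "finite T" by (rule finite_subset[OF T finite_dsimplices])
  have deg: "card {y\<in>T. adjacent d x y} \<ge> 3" if x: "x \<in> T" for x
  proof -
    note dx = dsimplicesD[OF subsetD[OF T x]]
    obtain g where g: "inj_on g x" "\<And>v. v \<in> x \<Longrightarrow> g v \<in> T \<and> g v \<noteq> x \<and> x - {v} \<subseteq> g v"
      using core_neighbours[OF core T x] by metis
    have "adjacent d x (g v)" if "v \<in> x" for v
      using g(2)[OF that] dx that unfolding adjacent_def by (auto intro!: exI[of _ "x - {v}"])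
    then have "g ` x \<subseteq> {y\<in>T. adjacent d x y}" using g(2) by auto
    then have "card (g ` x) \<le> card {y\<in>T. adjacent d x y}" by (rule card_mono[rotated]) (use fT in auto)
    then show ?thesis using card_image[OF g(1)] dx d by simp
  qed
  have irr: "\<not> adjacent d x x" for x by (simp add: adjacent_def)
  obtain A0 where A0: "A0 \<subseteq> T" "A0 \<noteq> {}" "conn (adjacent d) A0"
    "\<forall>x\<in>T - A0. \<exists>y\<in>A0. adjacent d x y" "card T \<le> 4 * card (T - A0) + 1"
    using ex_conn_dominating[OF symp_adjacent irr fT ne minimal_core_conn[OF mc] deg] by blast
  obtain R' where R': "R' \<subseteq> T - A0" "faces d T \<subseteq> faces d (T - R')"
    "card (T - A0) \<le> (d + 2) * card R'"
    using ex_removable_subset[OF core T Diff_subset] by blast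
  have "card T - 1 \<le> 4 * ((d + 2) * card R')" using A0(5) R'(3) by linarith
  then have "r \<le> (4 * (d + 2) * card R') div (4 * (d + 2))"
    unfolding r by (intro div_le_mono) (simp only: mult.assoc)
  also have "\<dots> = card R'" by simp
  \<comment> \<open>Deleting fewer simplices keeps the faces covered, so \<open>R'\<close> may be
    cut down to exactly \<open>r\<close> elements.\<close>
  finally obtain R'' where R'': "R'' \<subseteq> R'" "card R'' = r" using obtain_subset_with_card_n by metis
  define A where "A = T - R''"
  have R''T: "R'' \<subseteq> T" using R'' R' by blast
  have AA: "A0 \<subseteq> A" using R'' R' A0 by (auto simp: A_def)
  have TA: "T - A = R''" using R''T by (auto simp: A_def)
  show ?thesis
  proof (rule that[of A])
    show "conn (adjacent d) A"
      by (rule conn_superset[OF symp_adjacent A0(3,2) AA]) (use A0(4) in \<open>auto simp: A_def\<close>)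
    show "faces d T \<subseteq> faces d A" 
      using R'(2) R''(1) unfolding faces_def A_def by blast
    show "card A = card T - r"
      unfolding A_def using R''T R'' fT by (metis card_Diff_subset finite_subset)
  qed (use AA A0 R'' TA in \<open>auto simp: A_def\<close>)
qed

section \<open>Expected number of minimal cores of a given size\<close>

text \<open>A core is encoded as \<open>A \<union> R\<close>, with \<open>A\<close> connected of
  size \<open>m - r\<close> and \<open>R\<close> an \<open>r\<close>-subset of the simplices whose
  faces all lie in \<open>faces d A\<close>. The weights of connected sets absorb
  \<open>p ^ (m - r)\<close>; \<open>card_le_shadow\<close> bounds the choices of \<open>R\<close>,
  which carry \<open>p ^ r\<close>.\<close>

lemma sum_minimal_core_le:
  fixes p y :: real
  assumes d: "d \<ge> 2" and p: "0 \<le> p" "p < 1" and y: "0 \<le> y" "real ((d + 1) * m) \<le> y ^ d"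
    and r: "r = (m - 1) div (4 * (d + 2))"
  shows "(\<Sum>T | T \<subseteq> dsimplices n d \<and> minimal_core d T \<and> card T = m. p ^ m)
    \<le> real n ^ (d + 1) * (inverse (1 - p) ^ ((d + 1) * n)) ^ (m - r) *
       ((real ((d + 1) * m) * y * p) ^ r / fact r)"
proof -
  let ?V = "dsimplices n d" and ?Z = "real ((d + 1) * m) * y"
  define \<A> where "\<A> = {A. A \<subseteq> ?V \<and> conn (adjacent d) A \<and> A \<noteq> {} \<and> card A = m - r}"
  define M where "M = {T. T \<subseteq> ?V \<and> minimal_core d T \<and> card T = m}"
  define X where "X = (\<lambda>A. {\<sigma>\<in>?V. \<forall>x\<in>\<sigma>. \<sigma> - {x} \<in> faces d A})"
  define W where "W = (\<lambda>A. {R. R \<subseteq> X A \<and> card R = r})"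
  have fin: "finite \<A>" "finite M" "finite (X A)" "finite (W A)" for A
    by (rule finite_subset[of _ "Pow ?V"]; force simp: \<A>_def M_def)+
       (auto simp: X_def W_def intro: finite_subset[of _ "Pow ?V"])
  have rm: "r \<le> m" unfolding r by (meson diff_le_self div_le_dividend le_trans)
  have "M \<subseteq> (\<Union>A\<in>\<A>. (\<lambda>R. A \<union> R) ` W A)"
  proof
    fix T assume "T \<in> M"
    then have T: "T \<subseteq> ?V" "minimal_core d T" "card T = m" by (auto simp: M_def)
    obtain A where A: "A \<subseteq> T" "A \<noteq> {}" "conn (adjacent d) A" "faces d T \<subseteq> faces d A"
      "card (T - A) = r" "card A = card T - r"
      using ex_removable[OF d T(1,2), of r] r T(3) by blast
    have "\<sigma> - {x} \<in> faces d A" if "\<sigma> \<in> T" "x \<in> \<sigma>" for \<sigma> x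
    proof -
      have "card (\<sigma> - {x}) = d" using that T(1) dsimplicesD[of \<sigma> n d] by auto
      then have "\<sigma> - {x} \<in> faces d T" using that(1) by (auto simp: faces_def)
      then show ?thesis using A(4) by blast
    qed
    then have "T - A \<in> W A" using T(1) A(5) by (auto simp: W_def X_def)
    moreover have "A \<in> \<A>" using A T by (auto simp: \<A>_def)
    moreover have "T = A \<union> (T - A)" using A(1) by blast
    ultimately show "T \<in> (\<Union>A\<in>\<A>. (\<lambda>R. A \<union> R) ` W A)" by blast
  qed
  then have "card M \<le> card (\<Union>A\<in>\<A>. (\<lambda>R. A \<union> R) ` W A)"
    by (rule card_mono[rotated]) (use fin in auto)
  also have "\<dots> \<le> (\<Sum>A\<in>\<A>. card ((\<lambda>R. A \<union> R) ` W A))" by (rule card_UN_le[OF fin(1)])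
  also have "\<dots> \<le> (\<Sum>A\<in>\<A>. card (X A) choose r)"
    by (intro sum_mono order_trans[OF card_image_le]) (use fin in \<open>auto simp: W_def n_subsets\<close>)
  finally have cM: "card M \<le> (\<Sum>A\<in>\<A>. card (X A) choose r)" .
  have choose: "real (card (X A) choose r) \<le> ?Z ^ r / fact r" if "A \<in> \<A>" for A
  proof -
    have A: "A \<subseteq> ?V" "card A \<le> m" using that by (auto simp: \<A>_def)
    have E: "card (faces d A) \<le> (d + 1) * m"
      using card_faces_le(2)[OF A(1)] A(2) by (meson le_trans mult_le_mono2)
    have "real (card (X A)) \<le> real (card (faces d A)) * y"
    proof (rule card_le_shadow[where k=d])
      show "real (card (faces d A)) \<le> y ^ d" using E y(2) by linarith
      show "finite \<tau> \<and> card \<tau> = d" if "\<tau> \<in> faces d A" for \<tau>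
        using faces_finite[OF _ that] d by simp
    qed (use fin card_faces_le(1)[OF A(1)] d y in \<open>auto simp: X_def dest: dsimplicesD\<close>)
    also have "\<dots> \<le> ?Z" using E y(1) by (intro mult_right_mono of_nat_mono)
    finally have "real (card (X A)) ^ r \<le> ?Z ^ r" by (intro power_mono) auto
    moreover have "real (card (X A) choose r) * fact r \<le> real (card (X A)) ^ r"
      using binomial_fact_pow[of "card (X A)" r]
      by (metis of_nat_fact of_nat_le_iff of_nat_mult of_nat_power)
    ultimately show ?thesis by (simp add: field_simps)
  qed
  have "(\<Sum>T\<in>M. p ^ m) = real (card M) * p ^ m" by simp
  also have "\<dots> \<le> real (\<Sum>A\<in>\<A>. card (X A) choose r) * p ^ m"
    by (intro mult_right_mono of_nat_mono cM) (use p in auto)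
  also have "\<dots> = (\<Sum>A\<in>\<A>. real (card (X A) choose r) * p ^ m)" by (simp add: sum_distrib_right)
  also have "\<dots> \<le> (\<Sum>A\<in>\<A>. ?Z ^ r / fact r * p ^ m)"
    by (intro sum_mono mult_right_mono choose) (use p in auto)
  also have "\<dots> = (\<Sum>A\<in>\<A>. p ^ (m - r)) * ((?Z * p) ^ r / fact r)"
  proof -
    have "p ^ m = p ^ (m - r) * p ^ r" using rm by (simp flip: power_add)
    then show ?thesis by (simp add: power_mult_distrib)
  qed
  also have "\<dots> \<le> (real (card ?V) * (inverse (1 - p) ^ ((d + 1) * n)) ^ (m - r)) * ((?Z * p) ^ r / fact r)"
    unfolding \<A>_def by (intro mult_right_mono sum_conn_card_le card_adjacent_le) (use p y in auto)
  also have "\<dots> \<le> (real n ^ (d + 1) * (inverse (1 - p) ^ ((d + 1) * n)) ^ (m - r)) * ((?Z * p) ^ r / fact r)"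
  proof -
    have "real (card ?V) \<le> real n ^ (d + 1)"
      using of_nat_mono[OF card_dsimplices_le[of n d], where 'a=real] by simp
    then show ?thesis using p y by (intro mult_right_mono) auto
  qed
  finally show ?thesis by (simp only: M_def)
qed

section \<open>Vertex stars of a core and the number of its vertices\<close>

lemma core_vertex_degree:
  assumes core: "is_core d T" and T: "T \<subseteq> dsimplices n d" and \<sigma>: "\<sigma> \<in> T" "x \<in> \<sigma>"
  obtains g where "inj_on g (\<sigma> - {x})" "\<sigma> \<notin> g ` (\<sigma> - {x})"
    "insert \<sigma> (g ` (\<sigma> - {x})) \<subseteq> {s\<in>T. x \<in> s}" "\<forall>w\<in>\<sigma> - {x}. \<sigma> - {w} \<subseteq> g w"
    "card (insert \<sigma> (g ` (\<sigma> - {x}))) = d + 1"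
proof -
  note ds = dsimplicesD[OF subsetD[OF T \<sigma>(1)]]
  obtain g where g: "inj_on g \<sigma>"
    "\<And>v. v \<in> \<sigma> \<Longrightarrow> g v \<in> T \<and> g v \<noteq> \<sigma> \<and> \<sigma> - {v} \<subseteq> g v"
    using core_neighbours[OF core T \<sigma>(1)] by metis
  have inj: "inj_on g (\<sigma> - {x})" using g(1) by (rule inj_on_subset) auto
  have notin: "\<sigma> \<notin> g ` (\<sigma> - {x})" using g(2) by blast
  have "card (insert \<sigma> (g ` (\<sigma> - {x}))) = Suc (card (\<sigma> - {x}))"
    using notin ds(1) card_image[OF inj] by simp
  also have "\<dots> = d + 1" using ds \<sigma>(2) by simp
  finally show ?thesis using that[OF inj notin] g(2) \<sigma> by fastforce
qed

text \<open>Besides \<open>\<sigma>\<close>, a tight star consists only of neighbours of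
  \<open>\<sigma>\<close>, each obtained by replacing some \<open>w\<close> by a vertex
  \<open>z w\<close>. The core condition on faces of these neighbours forces all \<open>z w\<close>
  to agree.\<close>

lemma core_tight_star:
  assumes d: "d \<ge> 2" and core: "is_core d T" and T: "T \<subseteq> dsimplices n d"
    and \<sigma>: "\<sigma> \<in> T" "x \<in> \<sigma>" and tight: "card {s\<in>T. x \<in> s} = d + 1"
  obtains z where "z \<notin> \<sigma>"
    "{s\<in>T. x \<in> s} = insert \<sigma> ((\<lambda>w. insert z (\<sigma> - {w})) ` (\<sigma> - {x}))"
proof -
  have fT: "finite T" by (rule finite_subset[OF T finite_dsimplices])
  note ds = dsimplicesD[OF subsetD[OF T \<sigma>(1)]]
  obtain g where g: "inj_on g (\<sigma> - {x})" "\<sigma> \<notin> g ` (\<sigma> - {x})"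
    "insert \<sigma> (g ` (\<sigma> - {x})) \<subseteq> {s\<in>T. x \<in> s}" "\<forall>w\<in>\<sigma> - {x}. \<sigma> - {w} \<subseteq> g w"
    "card (insert \<sigma> (g ` (\<sigma> - {x}))) = d + 1"
    using core_vertex_degree[OF core T \<sigma>] by blast
  have star: "{s\<in>T. x \<in> s} = insert \<sigma> (g ` (\<sigma> - {x}))"
    using card_subset_eq[OF _ g(3)] fT g(5) tight by simp
  have "\<exists>z. z \<notin> \<sigma> \<and> g w = insert z (\<sigma> - {w})" if w: "w \<in> \<sigma> - {x}" for w
  proof -
    have gw: "g w \<in> T" "g w \<noteq> \<sigma>" using g(2,3) w by auto
    note dg = dsimplicesD[OF subsetD[OF T gw(1)]]
    have "card (\<sigma> - {w}) = d" using w ds by simp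
    then obtain z where z: "z \<in> g w" "\<sigma> - {w} = g w - {z}"
      using codim1_subset[OF _ bspec[OF g(4) w] dg(1,2)] by metis
    then have eq: "g w = insert z (\<sigma> - {w})" by blast
    moreover have "z \<notin> \<sigma>"
    proof
      assume "z \<in> \<sigma>"
      then have "g w \<subseteq> \<sigma>" using eq by auto
      then show False using card_subset_eq[OF ds(1)] gw(2) ds(2) dg(2) by simp
    qed
    ultimately show ?thesis by blast
  qed
  then obtain z where z: "\<And>w. w \<in> \<sigma> - {x} \<Longrightarrow> z w \<notin> \<sigma> \<and> g w = insert (z w) (\<sigma> - {w})" by metis
  have const: "z w1 = z w2" if w: "w1 \<in> \<sigma> - {x}" "w2 \<in> \<sigma> - {x}" "w1 \<noteq> w2" for w1 w2
  proof -
    \<comment> \<open>This face of \<open>g w1\<close> contains \<open>x\<close>, so its second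
      coface lies in the star. A simplex \<open>g w3\<close> misses \<open>w3\<close>, which leaves
      only \<open>g w2\<close>.\<close>
    let ?\<tau> = "insert (z w1) (\<sigma> - {w1, w2})"
    have "card (\<sigma> - {w1, w2}) = d - 1" using w ds by (simp add: card_Diff_subset)
    then have c: "card ?\<tau> = d" using z[OF w(1)] ds d by simp
    have "?\<tau> \<subseteq> g w1" using z[OF w(1)] by auto
    moreover have gw1: "g w1 \<in> T" using g(3) w by auto
    ultimately obtain s where s: "s \<in> T" "s \<noteq> g w1" "?\<tau> \<subseteq> s"
      using core_other[OF core _ _ c] by metis
    have "x \<in> s" using s(3) w \<sigma>(2) by auto
    then have "s \<in> insert \<sigma> (g ` (\<sigma> - {x}))" using star s(1) by blast
    moreover have "s \<noteq> \<sigma>" using s(3) z[OF w(1)] by auto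
    ultimately obtain w3 where w3: "w3 \<in> \<sigma> - {x}" "s = g w3" by blast
    have "w3 \<notin> s" using z[OF w3(1)] w3 by auto
    then have "w3 = w2" using s w3 by auto
    then show ?thesis using z[OF w(1)] z[OF w(2)] s(3) w3(2) by auto
  qed
  have "card (\<sigma> - {x}) = d" using ds \<sigma>(2) by simp
  then have "\<sigma> - {x} \<noteq> {}" using d by force
  then obtain w0 where w0: "w0 \<in> \<sigma> - {x}" by blast
  have "g w = insert (z w0) (\<sigma> - {w})" if "w \<in> \<sigma> - {x}" for w
    using z[OF that] const[OF that w0] by metis
  then have "g ` (\<sigma> - {x}) = (\<lambda>w. insert (z w0) (\<sigma> - {w})) ` (\<sigma> - {x})" by (rule image_cong[OF refl])
  then show ?thesis using that[of "z w0"] z[OF w0] star by simp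
qed

text \<open>The vertex degrees are at least \<open>d + 1\<close> and sum to
  \<open>(d + 1) * card T\<close>, so having at least as many vertices as simplices makes every star
  tight. The stars of two vertices of one simplex then share their apex and together fill the
  boundary of a \<open>(d + 1)\<close>-simplex.\<close>

lemma core_card_vertices_less:
  assumes d: "d \<ge> 2" and core: "is_core d T" and T: "T \<subseteq> dsimplices n d" and ne: "T \<noteq> {}"
    and nb: "\<not> contains_boundary d T"
  shows "card (\<Union>T) < card T"
proof (rule ccontr)
  assume contra: "\<not> card (\<Union>T) < card T"
  have fT: "finite T" by (rule finite_subset[OF T finite_dsimplices])
  have fU: "finite (\<Union>T)" using fT T dsimplicesD(1) by blast
  have ge: "d + 1 \<le> card {s\<in>T. v \<in> s}" if "v \<in> \<Union>T" for v
  proof -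
    from that obtain \<sigma> where s: "\<sigma> \<in> T" "v \<in> \<sigma>" by blast
    obtain B where "B \<subseteq> {s\<in>T. v \<in> s}" "card B = d + 1"
      using core_vertex_degree[OF core T s] by metis
    then show ?thesis using card_mono[of "{s\<in>T. v \<in> s}" B] fT by simp
  qed
  have tight: "card {s\<in>T. v \<in> s} = d + 1" if "v \<in> \<Union>T" for v
  proof (rule ccontr)
    assume "card {s\<in>T. v \<in> s} \<noteq> d + 1"
    then have "d + 1 < card {s\<in>T. v \<in> s}" using ge[OF that] by simp
    then have "(\<Sum>v\<in>\<Union>T. d + 1) < (\<Sum>v\<in>\<Union>T. card {s\<in>T. v \<in> s})"
      using that by (intro sum_strict_mono_ex1[OF fU]) (auto intro: ge[simplified])
    also have "\<dots> = (\<Sum>\<sigma>\<in>T. card \<sigma>)" by (rule sum_card_containing[OF fU fT order_refl])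
    also have "\<dots> = (\<Sum>\<sigma>\<in>T. d + 1)" using T dsimplicesD(2) by (intro sum.cong) auto
    finally have "(d + 1) * card (\<Union>T) < (d + 1) * card T" by (simp only: sum_constant mult.commute of_nat_id)
    then show False using contra by (metis mult_less_cancel1)
  qed
  obtain \<sigma> where \<sigma>: "\<sigma> \<in> T" using ne by blast
  note ds = dsimplicesD[OF subsetD[OF T \<sigma>]]
  have "3 \<le> card \<sigma>" using ds d by simp
  \<comment> \<open>The third vertex \<open>x3\<close> supplies a simplex
    \<open>insert z (\<sigma> - {x3})\<close> in the stars of both \<open>x1\<close> and
    \<open>x2\<close>; this identifies \<open>z'\<close> with \<open>z\<close>.\<close>
  then obtain S3 where "S3 \<subseteq> \<sigma>" "card S3 = 3" by (meson obtain_subset_with_card_n)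
  then obtain x1 x2 x3 where x: "x1 \<in> \<sigma>" "x2 \<in> \<sigma>" "x3 \<in> \<sigma>" "x1 \<noteq> x2" "x1 \<noteq> x3" "x2 \<noteq> x3"
    by (auto simp: card_3_iff)
  obtain z where z: "z \<notin> \<sigma>"
    "{s\<in>T. x1 \<in> s} = insert \<sigma> ((\<lambda>w. insert z (\<sigma> - {w})) ` (\<sigma> - {x1}))"
    using core_tight_star[OF d core T \<sigma> x(1) tight] \<sigma> x(1) by blast
  obtain z' where z': "z' \<notin> \<sigma>"
    "{s\<in>T. x2 \<in> s} = insert \<sigma> ((\<lambda>w. insert z' (\<sigma> - {w})) ` (\<sigma> - {x2}))"
    using core_tight_star[OF d core T \<sigma> x(2) tight] \<sigma> x(2) by blast
  have T1: "insert z (\<sigma> - {w}) \<in> T" if "w \<in> \<sigma>" "w \<noteq> x1" for w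
    using z(2) that by blast
  have T2: "insert z' (\<sigma> - {w}) \<in> T" if "w \<in> \<sigma>" "w \<noteq> x2" for w
    using z'(2) that by blast
  have "insert z (\<sigma> - {x3}) \<in> {s\<in>T. x2 \<in> s}" using T1[of x3] x by auto
  then have "z \<in> insert z' \<sigma>" unfolding z'(2) using z(1) by auto
  then have zz: "z' = z" using z(1) by auto
  have "{s. s \<subseteq> insert z \<sigma> \<and> card s = d + 1} \<subseteq> T"
  proof safe
    fix s assume s: "s \<subseteq> insert z \<sigma>" "card s = d + 1"
    obtain w where w: "w \<in> insert z \<sigma>" "s = insert z \<sigma> - {w}"
      using codim1_subset[OF s(2,1)] ds z(1) by auto
    \<comment> \<open>The star of \<open>x1\<close> contains every facet except the one omitting
      \<open>x1\<close>, which comes from the star of \<open>x2\<close>.\<close>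
    show "s \<in> T"
    proof (cases "w = z")
      case True
      then show ?thesis using w z(1) \<sigma> by simp
    next
      case False
      then have "w \<in> \<sigma>" "s = insert z (\<sigma> - {w})" using w by auto
      then show ?thesis using T1[of w] T2[of w] zz x(4) by metis
    qed
  qed
  moreover have "finite (insert z \<sigma>)" "card (insert z \<sigma>) = d + 2" using ds z(1) by auto
  ultimately show False using nb unfolding contains_boundary_def by blast
qed

text \<open>Having at most \<open>m - 1\<close> vertices, such a core is a set of subsets of the
  entries of a list of length \<open>m - 1\<close>. The exponent of \<open>n\<close> is one less
  than that of \<open>p\<close>, which leaves a factor \<open>1 / n\<close> when
  \<open>p = c / n\<close>.\<close>

lemma sum_small_core_le:
  fixes p :: real
  assumes d: "d \<ge> 2" and p: "0 \<le> p"
  shows "(\<Sum>T | T \<subseteq> dsimplices n d \<and> minimal_core d T \<and> \<not> contains_boundary d T \<and> card T = m. p ^ m)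
    \<le> real n ^ (m - 1) * 2 ^ (2 ^ (m - 1)) * p ^ m"
proof -
  define M where "M = {T. T \<subseteq> dsimplices n d \<and> minimal_core d T \<and> \<not> contains_boundary d T \<and> card T = m}"
  define L where "L = {xs. set xs \<subseteq> {..<n} \<and> length xs = m - 1}"
  have finL: "finite L" unfolding L_def by (rule finite_lists_length_eq) simp
  have "M \<subseteq> (\<Union>xs\<in>L. Pow (Pow (set xs)))"
  proof
    fix T assume "T \<in> M"
    then have T: "T \<subseteq> dsimplices n d" "is_core d T" "T \<noteq> {}" "\<not> contains_boundary d T" "card T = m"
      by (auto simp: M_def minimal_core_def)
    have "card (\<Union>T) < m" using core_card_vertices_less[OF d T(2,1,3,4)] T(5) by simp
    moreover have sub: "\<Union>T \<subseteq> {..<n}" using T(1) dsimplicesD(3) by blast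
    moreover have "\<Union>T \<noteq> {}" using T(1,3) dsimplicesD(2) by fastforce
    ultimately obtain xs where "set xs = \<Union>T" "distinct xs" "xs \<noteq> []" "length xs \<le> m - 1"
      using finite_distinct_list[of "\<Union>T"] finite_subset[OF sub]
      by (metis Suc_diff_1 distinct_card finite_lessThan gr_zeroI less_Suc_eq_le not_less0 set_empty)
    \<comment> \<open>Repeating the head pads the list to length exactly \<open>m - 1\<close>
      without changing its set of entries.\<close>
    then have "set (xs @ replicate (m - 1 - length xs) (hd xs)) = \<Union>T"
      "length (xs @ replicate (m - 1 - length xs) (hd xs)) = m - 1"
      by auto
    then show "T \<in> (\<Union>xs\<in>L. Pow (Pow (set xs)))"
      using sub unfolding L_def by (metis (mono_tags, lifting) PowI UN_iff mem_Collect_eq subset_Pow_Union)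
  qed
  then have "card M \<le> card (\<Union>xs\<in>L. Pow (Pow (set xs)))"
    by (rule card_mono[rotated]) (use finL in auto)
  also have "\<dots> \<le> (\<Sum>xs\<in>L. card (Pow (Pow (set xs))))" by (rule card_UN_le[OF finL])
  also have "\<dots> \<le> (\<Sum>xs\<in>L. 2 ^ (2 ^ (m - 1)))"
    by (rule sum_mono) (auto simp: card_Pow L_def intro!: power_increasing card_length[THEN order_trans])
  also have "\<dots> = n ^ (m - 1) * 2 ^ (2 ^ (m - 1))"
    unfolding L_def using card_lists_length_eq[of "{..<n}" "m - 1"] by simp
  finally have "real (card M) \<le> real (n ^ (m - 1) * 2 ^ (2 ^ (m - 1)))" by (rule of_nat_mono)
  then have "real (card M) * p ^ m \<le> real n ^ (m - 1) * 2 ^ (2 ^ (m - 1)) * p ^ m"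
    using p by (intro mult_right_mono) auto
  then show ?thesis by (simp add: M_def)
qed

section \<open>Summing over all sizes\<close>

text \<open>A single term of the exponential series. It serves both for
  \<open>r ^ r / fact r <= exp r\<close> and for comparing powers with \<open>exp\<close>.\<close>

lemma power_div_fact_le_exp:
  fixes x :: real
  assumes "0 \<le> x"
  shows "x ^ n / fact n \<le> exp x"
proof -
  have s: "(\<lambda>n. x ^ n / fact n) sums exp x"
    using exp_converges[of x] by (simp add: field_simps)
  have "(\<Sum>k\<in>{n}. x ^ k / fact k) \<le> (\<Sum>k. x ^ k / fact k)"
    by (rule sum_le_suminf) (use assms sums_summable[OF s] in auto)
  then show ?thesis using sums_unique[OF s] by simp
qed

text \<open>For \<open>p = c / n\<close> at most 1/2, \<open>1 / (1 - p) <= exp (2 * p)\<close>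
  bounds the growth factor per simplex by the constant \<open>C\<close>. As
  \<open>m <= 2 * q * r\<close>, the quotient \<open>m ^ r / fact r\<close> is at most exponential
  in \<open>r\<close>, and the constants collect in \<open>K\<close>.\<close>

lemma sum_minimal_core_le_power:
  fixes c y :: real and d m n :: nat
  defines "q \<equiv> 4 * (d + 2)"
  defines "C \<equiv> exp (2 * c * real (d + 1))"
  defines "K \<equiv> C ^ q * real (d + 1) * real (2 * q) * c * exp 1"
  assumes d: "d \<ge> 2" and c: "c > 0" "2 * c \<le> real n" and y: "0 \<le> y" "real ((d + 1) * m) \<le> y ^ d"
    and r: "r = (m - 1) div q" "r \<ge> 1"
  shows "(\<Sum>T | T \<subseteq> dsimplices n d \<and> minimal_core d T \<and> card T = m. (c / real n) ^ m)
    \<le> real n ^ (d + 1) * C ^ q * (K * y / real n) ^ r"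
proof -
  define p where "p = c / real n"
  have n: "real n > 0" using c by linarith
  have p: "0 \<le> p" "p \<le> 1 / 2" using c n by (auto simp: p_def field_simps)
  define G where "G = inverse (1 - p) ^ ((d + 1) * n)"
  have "1 \<le> (1 + 2 * p) * (1 - p)"
    using mult_nonneg_nonneg[of p "1 - 2 * p"] p by (simp add: algebra_simps)
  then have "inverse (1 - p) \<le> 1 + 2 * p" using p by (simp add: field_simps)
  also have "\<dots> \<le> exp (2 * p)" by (rule exp_ge_add_one_self)
  finally have "G \<le> exp (2 * p) ^ ((d + 1) * n)"
    unfolding G_def by (rule power_mono) (use p in auto)
  also have "\<dots> = exp (real ((d + 1) * n) * (2 * p))" by (rule exp_of_nat_mult[symmetric])
  also have "real ((d + 1) * n) * (2 * p) = 2 * c * real (d + 1)"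
    using n by (simp add: p_def field_simps)
  finally have GC: "G \<le> C" by (simp only: C_def)
  have G0: "0 \<le> G" using p by (auto simp: G_def)
  have C1: "1 \<le> C" using c by (simp add: C_def)
  have q0: "q > 0" by (simp add: q_def)
  \<comment> \<open>Rounding in the division costs one more block of \<open>q\<close>, whence the
    separate factor \<open>C ^ q\<close>; \<open>r \<ge> 1\<close> then allows the cleaner bound
    \<open>2 * q * r\<close>.\<close>
  have "m - 1 < (r + 1) * q" 
    unfolding r using dividend_less_times_div[OF q0, of "m - 1"] by (simp add: algebra_simps)
  then have mq: "m \<le> q * (r + 1)" by (simp add: mult.commute)
  also have "\<dots> \<le> q * (2 * r)" using r(2) by (intro mult_le_mono2) auto
  finally have m2: "m \<le> 2 * q * r" by simp
  have "G ^ (m - r) \<le> C ^ (m - r)" by (rule power_mono[OF GC G0])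
  also have "\<dots> \<le> C ^ (q * (r + 1))" using C1 mq by (intro power_increasing) auto
  also have "\<dots> = C ^ q * (C ^ q) ^ r" by (simp add: power_add power_mult)
  finally have G: "G ^ (m - r) \<le> C ^ q * (C ^ q) ^ r" .
  let ?a = "real (d + 1) * real (2 * q) * y * p"
  have a0: "0 \<le> ?a" using p y by simp
  have "real ((d + 1) * m) * y * p \<le> real ((d + 1) * (2 * q * r)) * y * p"
    by (intro mult_right_mono of_nat_mono mult_le_mono2 m2) (use p y in auto)
  also have "\<dots> = ?a * real r" by (simp only: of_nat_mult) (simp only: ac_simps)
  finally have "(real ((d + 1) * m) * y * p) ^ r / fact r \<le> (?a * real r) ^ r / fact r"
    by (intro divide_right_mono power_mono) (use p y in auto)
  also have "\<dots> = ?a ^ r * (real r ^ r / fact r)" by (simp add: power_mult_distrib)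
  also have "\<dots> \<le> ?a ^ r * exp (real r)"
    by (intro mult_left_mono power_div_fact_le_exp zero_le_power a0) simp
  also have "exp (real r) = exp 1 ^ r" using exp_of_nat_mult[of r "1::real"] by simp
  finally have Z: "(real ((d + 1) * m) * y * p) ^ r / fact r \<le> ?a ^ r * exp 1 ^ r" .
  have "(\<Sum>T | T \<subseteq> dsimplices n d \<and> minimal_core d T \<and> card T = m. p ^ m)
      \<le> real n ^ (d + 1) * G ^ (m - r) * ((real ((d + 1) * m) * y * p) ^ r / fact r)"
    unfolding G_def by (rule sum_minimal_core_le[OF d _ _ y]) (use p r in \<open>auto simp: q_def\<close>)
  also have "\<dots> \<le> real n ^ (d + 1) * (C ^ q * (C ^ q) ^ r) * (?a ^ r * exp 1 ^ r)"
    by (intro mult_mono G Z order_refl) (use G0 C1 a0 p y in auto)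
  also have "\<dots> = real n ^ (d + 1) * C ^ q * (C ^ q * ?a * exp 1) ^ r"
    by (simp only: power_mult_distrib ac_simps)
  also have "C ^ q * ?a * exp 1 = K * y / real n"
    by (simp add: K_def p_def)
  finally show ?thesis by (simp only: p_def)
qed

text \<open>Union bound: the weight of a set \<open>S\<close> outside the event is charged to every
  \<open>T\<close> in \<open>B\<close> that it contains, and all supersets of \<open>T\<close>
  together weigh \<open>p ^ card T\<close>.\<close>

lemma Yprob_bounds:
  assumes p: "0 \<le> p" "p \<le> 1" and B: "B \<subseteq> Pow (dsimplices n d)"
    and bad: "\<And>S. S \<subseteq> dsimplices n d \<Longrightarrow> \<not> E S \<Longrightarrow> \<exists>T\<in>B. T \<subseteq> S"
  shows "1 - (\<Sum>T\<in>B. p ^ card T) \<le> Yprob n d p E" "Yprob n d p E \<le> 1"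
proof -
  let ?V = "dsimplices n d"
  let ?w = "\<lambda>S::nat set set. p ^ card S * (1 - p) ^ (card ?V - card S)"
  let ?N = "{S. S \<subseteq> ?V \<and> \<not> E S}"
  have w0: "0 \<le> ?w S" for S using p by simp
  have finB: "finite B" by (rule finite_subset[OF B]) simp
  have fin: "finite ?N" "finite {S. S \<subseteq> ?V \<and> E S}"
    by (auto intro: finite_subset[of _ "Pow ?V"])
  have "1 = (\<Sum>S | {} \<subseteq> S \<and> S \<subseteq> ?V. ?w S)"
    using sum_bernoulli_superset[of ?V "{}" p] by simp
  also have "{S. {} \<subseteq> S \<and> S \<subseteq> ?V} = {S. S \<subseteq> ?V \<and> E S} \<union> ?N" by auto
  also have "sum ?w \<dots> = Yprob n d p E + sum ?w ?N"
    unfolding Yprob_def by (rule sum.union_disjoint[OF fin(2,1)]) auto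
  finally have total: "1 = Yprob n d p E + sum ?w ?N" .
  moreover have "0 \<le> sum ?w ?N" by (rule sum_nonneg) (rule w0)
  ultimately show "Yprob n d p E \<le> 1" by linarith
  have "sum ?w ?N \<le> (\<Sum>S\<in>?N. \<Sum>T\<in>B. if T \<subseteq> S then ?w S else 0)"
  proof (rule sum_mono)
    fix S assume "S \<in> ?N"
    then obtain T where T: "T \<in> B" "T \<subseteq> S" using bad by blast
    have "?w S = (if T \<subseteq> S then ?w S else 0)" using T by simp
    also have "\<dots> \<le> (\<Sum>T\<in>B. if T \<subseteq> S then ?w S else 0)"
      by (rule member_le_sum[OF T(1)]) (use w0 finB in auto)
    finally show "?w S \<le> (\<Sum>T\<in>B. if T \<subseteq> S then ?w S else 0)" .
  qed
  also have "\<dots> = (\<Sum>T\<in>B. \<Sum>S\<in>?N. if T \<subseteq> S then ?w S else 0)" by (rule sum.swap)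
  also have "\<dots> \<le> (\<Sum>T\<in>B. \<Sum>S | T \<subseteq> S \<and> S \<subseteq> ?V. ?w S)"
  proof (rule sum_mono)
    fix T assume "T \<in> B"
    have "(\<Sum>S\<in>?N. if T \<subseteq> S then ?w S else 0) = sum ?w {S\<in>?N. T \<subseteq> S}"
      by (rule sum.inter_filter[symmetric, OF fin(1)])
    also have "\<dots> \<le> (\<Sum>S | T \<subseteq> S \<and> S \<subseteq> ?V. ?w S)"
      by (rule sum_mono2) (use w0 in \<open>auto intro: finite_subset[of _ "Pow ?V"]\<close>)
    finally show "(\<Sum>S\<in>?N. if T \<subseteq> S then ?w S else 0) \<le> (\<Sum>S | T \<subseteq> S \<and> S \<subseteq> ?V. ?w S)" .
  qed
  also have "\<dots> = (\<Sum>T\<in>B. p ^ card T)"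
    by (intro sum.cong refl sum_bernoulli_superset) (use B in auto)
  finally show "1 - (\<Sum>T\<in>B. p ^ card T) \<le> Yprob n d p E" using total by linarith
qed

definition bad_cores :: "nat \<Rightarrow> nat \<Rightarrow> real \<Rightarrow> nat set set set" where
  "bad_cores n d \<delta> = {T. T \<subseteq> dsimplices n d \<and> minimal_core d T \<and> \<not> contains_boundary d T \<and>
     real (card T) \<le> \<delta> * real n ^ d}"

text \<open>Bounded sizes are controlled by the number of vertices. Otherwise
  \<open>sum_minimal_core_le_power\<close> is applied with \<open>y\<close> of order \<open>sqrt n\<close> for \<open>m \<le> sqrt n\<close>, and with
  \<open>y = \<theta> * n\<close> for larger \<open>m\<close>, where \<open>\<theta>\<close> makes the last factor \<open>exp (- r)\<close>.\<close>

lemma sum_bad_cores_le: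
  assumes d: "d \<ge> 2" and c: "c > (0::real)"
  obtains \<delta> B :: real and n0 :: nat where "\<delta> > 0"
    "\<And>n. n \<ge> n0 \<Longrightarrow> (\<Sum>T\<in>bad_cores n d \<delta>. (c / real n) ^ card T) \<le> B / real n"
proof -
  define q where "q = 4 * (d + 2)"
  define C where "C = exp (2 * c * real (d + 1))"
  define K where "K = C ^ q * real (d + 1) * real (2 * q) * c * exp 1"
  define \<theta> where "\<theta> = exp (-1) / K"
  \<comment> \<open>With this \<open>\<delta>\<close>, \<open>m \<le> \<delta> * n ^ d\<close> says
    that \<open>(d + 1) * m \<le> (\<theta> * n) ^ d\<close>, the condition required of
    \<open>y = \<theta> * n\<close>.\<close>
  define \<delta> where "\<delta> = \<theta> ^ d / real (d + 1)"
  \<comment> \<open>For \<open>y = (d + 1) * sqrt n\<close> each of the \<open>r\<close> factors is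
    of order \<open>1 / sqrt n\<close>, and \<open>R\<close> of them turn \<open>n ^ (d + 1)\<close>
    into \<open>1 / n ^ 2\<close>. Sizes above \<open>M\<close> have
    \<open>r \<ge> R\<close>.\<close>
  define R where "R = 2 * (d + 3)"
  define M where "M = q * R"
  \<comment> \<open>For \<open>m > sqrt n\<close> the number \<open>r\<close> is at least of order
    \<open>sqrt n\<close>, so \<open>n ^ (2 * d + 2)\<close> is at most a constant times
    \<open>r ^ J\<close>, hence times \<open>exp r\<close>; this turns the prefactor
    \<open>n ^ (d + 1)\<close> into \<open>1 / n ^ (d + 1)\<close>.\<close>
  define J where "J = 2 * (2 * d + 2)"
  define b1 where "b1 = (\<lambda>m. 2 ^ (2 ^ (m - 1)) * c ^ m :: real)"
  define b2 where "b2 = C ^ q * (K * real (d + 1)) ^ R"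
  define b3 where "b3 = C ^ q * (fact J * real (2 * q) ^ J)"
  \<comment> \<open>There are \<open>M\<close> terms of order \<open>1 / n\<close>, at most
    \<open>n\<close> of order \<open>1 / n ^ 2\<close> and at most \<open>\<delta> * n ^ d\<close>
    of order \<open>1 / n ^ (d + 1)\<close>; each group contributes \<open>O(1 / n)\<close>.\<close>
  define B where "B = (\<Sum>m\<in>{1..M}. b1 m) + b2 + \<delta> * b3"
  \<comment> \<open>The summand \<open>2 * c\<close> ensures \<open>p \<le> 1 / 2\<close>; the
    square keeps the base \<open>K * (d + 1) / sqrt n\<close> at most 1, so that its exponent may be
    lowered to \<open>R\<close>.\<close>
  define n0 where "n0 = nat \<lceil>2 * c + (K * real (d + 1))\<^sup>2\<rceil>"
  have q0: "q > 0" by (simp add: q_def)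
  have C0: "C > 0" by (simp add: C_def)
  have K0: "K > 0" using C0 c q0 by (simp add: K_def)
  have \<theta>0: "\<theta> > 0" using K0 by (simp add: \<theta>_def)
  have \<delta>0: "\<delta> > 0" using \<theta>0 by (simp add: \<delta>_def)
  have b0: "b1 m \<ge> 0" "b2 \<ge> 0" "b3 \<ge> 0" for m
    using c C0 K0 by (auto simp: b1_def b2_def b3_def)
  have "(\<Sum>T\<in>bad_cores n d \<delta>. (c / real n) ^ card T) \<le> B / real n" if "n \<ge> n0" for n
  proof -
    let ?p = "c / real n"
    define N where "N = nat \<lfloor>\<delta> * real n ^ d\<rfloor>"
    define F where "F = (\<lambda>m. {T. T \<subseteq> dsimplices n d \<and> minimal_core d T \<and> card T = m})"
    define F' where "F' = (\<lambda>m. {T. T \<subseteq> dsimplices n d \<and> minimal_core d T \<and> \<not> contains_boundary d T \<and> card T = m})"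
    have finF: "finite (F m)" for m
      by (rule finite_subset[of _ "Pow (dsimplices n d)"]) (auto simp: F_def)
    have "2 * c + (K * real (d + 1))\<^sup>2 \<le> real n" using that unfolding n0_def by linarith
    then have n2c: "2 * c \<le> real n" and nK: "(K * real (d + 1))\<^sup>2 \<le> real n"
      using c zero_le_power2[of "K * real (d + 1)"] by linarith+
    then have n: "real n > 0" "n \<ge> 1" using c by linarith+
    have F'F: "(\<Sum>T\<in>F' m. ?p ^ m) \<le> (\<Sum>T\<in>F m. ?p ^ m)" for m
      by (rule sum_mono2[OF finF]) (use c n in \<open>auto simp: F_def F'_def\<close>)
    have small: "(\<Sum>T\<in>F' m. ?p ^ m) \<le> b1 m / real n" if "m \<ge> 1" for m
    proof -
      have "(\<Sum>T\<in>F' m. ?p ^ m) \<le> real n ^ (m - 1) * 2 ^ (2 ^ (m - 1)) * ?p ^ m"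
        unfolding F'_def by (rule sum_small_core_le[OF d]) (use c n in auto)
      also have "\<dots> = b1 m / real n"
        using that n by (cases m) (auto simp: b1_def power_divide field_simps)
      finally show ?thesis .
    qed
    have r: "(m - 1) div q \<ge> R \<and> (m - 1) div q \<ge> 1" if "m > M" for m
    proof -
      have "R * q \<le> m - 1" using that by (simp add: M_def mult.commute)
      then have "R \<le> (m - 1) div q" using q0 by (simp add: less_eq_div_iff_mult_less_eq)
      then show ?thesis by (simp add: R_def)
    qed
    have medium: "(\<Sum>T\<in>F' m. ?p ^ m) \<le> b2 / (real n)\<^sup>2" if m: "m > M" "m\<^sup>2 \<le> n" for m
    proof -
      define s where "s = sqrt (real n)"
      have ns: "real n = s * s" and s0: "s > 0" "s \<ge> 1" using n by (auto simp: s_def)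
      define y where "y = real (d + 1) * s"
      define t where "t = (m - 1) div q"
      have "real m \<le> s" unfolding s_def using m(2) by (metis of_nat_le_iff of_nat_power real_le_rsqrt)
      then have "real (d + 1) * real m \<le> y" unfolding y_def by (intro mult_left_mono) auto
      then have "real ((d + 1) * m) \<le> y" by (simp only: of_nat_mult)
      moreover have y1: "y \<ge> 1"
      proof -
        have "1 * 1 \<le> real (d + 1) * s" by (rule mult_mono) (use s0 in auto)
        then show ?thesis by (simp add: y_def)
      qed
      ultimately have my: "real ((d + 1) * m) \<le> y ^ d"
        using self_le_power[OF y1, of d] d by linarith
      have "K * real (d + 1) \<le> s" unfolding s_def using nK by (rule real_le_rsqrt)
      then have le1: "K * real (d + 1) / s \<le> 1" using s0 by simp
      have "(\<Sum>T\<in>F m. ?p ^ m) \<le> real n ^ (d + 1) * C ^ q * (K * y / real n) ^ t"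
        unfolding F_def C_def K_def q_def
        by (rule sum_minimal_core_le_power[OF d c n2c _ my]) (use y1 r[OF m(1)] in \<open>auto simp: t_def q_def\<close>)
      also have "K * y / real n = K * real (d + 1) / s"
        unfolding y_def ns using s0 by simp
      also have "real n ^ (d + 1) * C ^ q * (K * real (d + 1) / s) ^ t
          \<le> real n ^ (d + 1) * C ^ q * (K * real (d + 1) / s) ^ R"
        using r[OF m(1)] C0 K0 n le1 s0
        by (intro mult_left_mono power_decreasing) (auto simp: t_def)
      also have "\<dots> = b2 * (real n ^ (d + 1) / s ^ R)"
        by (simp add: b2_def power_divide)
      also have "R = 2 * ((d + 1) + 2)" by (simp add: R_def)
      also have "s ^ \<dots> = (s\<^sup>2) ^ ((d + 1) + 2)" by (rule power_mult)
      also have "\<dots> = real n ^ (d + 1) * (real n)\<^sup>2" unfolding ns power_add power2_eq_square ..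
      also have "b2 * (real n ^ (d + 1) / (real n ^ (d + 1) * (real n)\<^sup>2)) = b2 / (real n)\<^sup>2"
        using n by simp
      finally show ?thesis using F'F[of m] by linarith
    qed
    have large: "(\<Sum>T\<in>F' m. ?p ^ m) \<le> b3 / real n ^ (d + 1)"
      if m: "m > M" "m\<^sup>2 > n" "real m \<le> \<delta> * real n ^ d" for m
    proof -
      define t where "t = (m - 1) div q"
      have t: "t \<ge> 1" using r[OF m(1)] by (simp add: t_def)
      have "real (d + 1) * real m \<le> real (d + 1) * (\<delta> * real n ^ d)"
        using m(3) by (intro mult_left_mono) auto
      also have "\<dots> = (\<theta> * real n) ^ d" by (simp add: \<delta>_def power_mult_distrib)
      finally have my: "real ((d + 1) * m) \<le> (\<theta> * real n) ^ d" by (simp only: of_nat_mult)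
      have "m - 1 < (t + 1) * q" 
        unfolding t_def using dividend_less_times_div[OF q0, of "m - 1"] by (simp add: algebra_simps)
      then have "m \<le> q * (t + 1)" by (simp add: mult.commute)
      also have "\<dots> \<le> q * (2 * t)" using t by (intro mult_le_mono2) auto
      finally have "m\<^sup>2 \<le> (2 * q * t)\<^sup>2" by (intro power_mono) auto
      then have "real n \<le> real ((2 * q * t)\<^sup>2)" using m(2) by (intro of_nat_mono) linarith
      then have "real n \<le> (real (2 * q) * real t)\<^sup>2" by (simp only: of_nat_mult of_nat_power)
      then have "real n ^ (2 * d + 2) \<le> ((real (2 * q) * real t)\<^sup>2) ^ (2 * d + 2)"
        by (intro power_mono) auto
      also have "\<dots> = real (2 * q) ^ J * real t ^ J"
        unfolding J_def power_mult[symmetric] power_mult_distrib ..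
      also have "real t ^ J \<le> fact J * exp (real t)"
        using power_div_fact_le_exp[of "real t" J] by (simp add: field_simps)
      finally have nt: "real n ^ (2 * d + 2) \<le> real (2 * q) ^ J * (fact J * exp (real t))"
        by (simp add: mult_left_mono)
      have "(\<Sum>T\<in>F m. ?p ^ m) \<le> real n ^ (d + 1) * C ^ q * (K * (\<theta> * real n) / real n) ^ t"
        unfolding F_def C_def K_def q_def
        by (rule sum_minimal_core_le_power[OF d c n2c _ my]) (use \<theta>0 t in \<open>auto simp: t_def q_def\<close>)
      also have "K * (\<theta> * real n) / real n = exp (-1)" using n K0 by (simp add: \<theta>_def)
      also have "exp (-1) ^ t = inverse (exp (real t))"
        using exp_of_nat_mult[of t "-1::real"] by (simp add: exp_minus)
      also have "real n ^ (d + 1) * C ^ q * inverse (exp (real t)) \<le> b3 / real n ^ (d + 1)"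
      proof -
        have "real n ^ (d + 1) * C ^ q * real n ^ (d + 1) = C ^ q * real n ^ (2 * d + 2)"
          by (simp add: mult_2 power_add)
        also have "\<dots> \<le> C ^ q * (real (2 * q) ^ J * (fact J * exp (real t)))"
          using nt C0 by (intro mult_left_mono) auto
        also have "\<dots> = b3 * exp (real t)" by (simp add: b3_def)
        finally show ?thesis using n by (simp add: field_simps)
      qed
      finally show ?thesis using F'F[of m] by linarith
    qed
    \<comment> \<open>The second term is charged to all sizes up to \<open>n\<close>, which include
      those with \<open>m ^ 2 \<le> n\<close>, and the third to every size.\<close>
    have each: "(\<Sum>T\<in>F' m. ?p ^ m) \<le> (if m \<in> {1..M} then b1 m / real n else 0) +
        (if m \<in> {1..n} then b2 / (real n)\<^sup>2 else 0) + b3 / real n ^ (d + 1)" if m: "m \<in> {1..N}" for m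
    proof -
      have nonneg: "b1 m / real n \<ge> 0" "b2 / (real n)\<^sup>2 \<ge> 0" "b3 / real n ^ (d + 1) \<ge> 0"
        using b0 n by auto
      have md: "real m \<le> \<delta> * real n ^ d"
        using m \<delta>0 unfolding N_def by (auto simp: le_nat_floor le_floor_iff nat_le_iff le_nat_iff)
      consider "m \<le> M" | "m > M" "m\<^sup>2 \<le> n" | "m > M" "m\<^sup>2 > n" by linarith
      then show ?thesis
      proof cases
        case 1
        then show ?thesis using small[of m] m nonneg by auto
      next
        case 2
        then have "m \<le> n" using m by (metis atLeastAtMost_iff le_trans power2_nat_le_imp_le)
        then show ?thesis using medium[OF 2] m nonneg by auto
      next
        case 3
        then show ?thesis using large[OF 3 md] m nonneg by auto
      qed
    qed
    have fin: "finite (bad_cores n d \<delta>)"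
      by (rule finite_subset[of _ "Pow (dsimplices n d)"]) (auto simp: bad_cores_def)
    have cardin: "card T \<in> {1..N}" if "T \<in> bad_cores n d \<delta>" for T
    proof -
      have "finite T" "T \<noteq> {}"
        using that finite_subset[OF _ finite_dsimplices] by (auto simp: bad_cores_def minimal_core_def)
      then show ?thesis using that unfolding N_def
        by (auto simp: bad_cores_def le_nat_floor card_gt_0_iff Suc_le_eq)
    qed
    have "(\<Sum>T\<in>bad_cores n d \<delta>. ?p ^ card T) =
        (\<Sum>m\<in>{1..N}. \<Sum>T | T \<in> bad_cores n d \<delta> \<and> card T = m. ?p ^ card T)"
      by (rule sum.group[symmetric, OF fin]) (use cardin in auto)
    also have "\<dots> \<le> (\<Sum>m\<in>{1..N}. \<Sum>T\<in>F' m. ?p ^ m)"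
    proof (rule sum_mono)
      fix m
      have "(\<Sum>T | T \<in> bad_cores n d \<delta> \<and> card T = m. ?p ^ card T)
          = (\<Sum>T | T \<in> bad_cores n d \<delta> \<and> card T = m. ?p ^ m)" by (rule sum.cong) auto
      also have "\<dots> \<le> (\<Sum>T\<in>F' m. ?p ^ m)"
        by (rule sum_mono2)
          (use c n in \<open>auto simp: F'_def bad_cores_def intro: finite_subset[of _ "Pow (dsimplices n d)"]\<close>)
      finally show "(\<Sum>T | T \<in> bad_cores n d \<delta> \<and> card T = m. ?p ^ card T) \<le> (\<Sum>T\<in>F' m. ?p ^ m)" .
    qed
    also have "\<dots> \<le> (\<Sum>m\<in>{1..N}. (if m \<in> {1..M} then b1 m / real n else 0) +
        (if m \<in> {1..n} then b2 / (real n)\<^sup>2 else 0) + b3 / real n ^ (d + 1))"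
      by (rule sum_mono[OF each])
    also have "\<dots> = (\<Sum>m\<in>{1..N} \<inter> {1..M}. b1 m / real n) + (\<Sum>m\<in>{1..N} \<inter> {1..n}. b2 / (real n)\<^sup>2)
        + real N * (b3 / real n ^ (d + 1))"
      by (simp only: sum.distrib sum.inter_restrict finite_atLeastAtMost) simp
    also have "\<dots> \<le> (\<Sum>m\<in>{1..M}. b1 m / real n) + (\<Sum>m\<in>{1..n}. b2 / (real n)\<^sup>2)
        + (\<delta> * real n ^ d) * (b3 / real n ^ (d + 1))"
      by (intro add_mono sum_mono2 mult_right_mono) (use b0 n \<delta>0 in \<open>auto simp: N_def\<close>)
    also have "\<dots> = B / real n"
      unfolding sum_divide_distrib[symmetric] using n by (simp add: B_def power2_eq_square field_simps)
    finally show ?thesis .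
  qed
  with \<delta>0 show ?thesis using that by blast
qed

theorem theorem7:
  fixes d :: nat
  assumes "d \<ge> 2"
  shows "\<forall>c::real. c > 0 \<longrightarrow> (\<exists>\<delta>::real. \<delta> > 0 \<and>
     (\<lambda>n. Yprob n d (c / real n)
        (\<lambda>S. \<forall>T. T \<subseteq> S \<and> minimal_core d T \<and> real (card T) \<le> \<delta> * real n ^ d
               \<longrightarrow> contains_boundary d T)) \<longlonglongrightarrow> 1)"
proof (intro allI impI)
  fix c :: real assume c: "c > 0"
  obtain \<delta> B :: real and n0 where \<delta>: "\<delta> > 0"
    and B: "\<And>n. n \<ge> n0 \<Longrightarrow> (\<Sum>T\<in>bad_cores n d \<delta>. (c / real n) ^ card T) \<le> B / real n"
    using sum_bad_cores_le[OF assms c] by metis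
  let ?E = "\<lambda>n S. \<forall>T. T \<subseteq> S \<and> minimal_core d T \<and> real (card T) \<le> \<delta> * real n ^ d
               \<longrightarrow> contains_boundary d T"
  \<comment> \<open>From \<open>nat \<lceil>c\<rceil>\<close> on, \<open>c / n\<close> is at most 1
    and hence a genuine probability.\<close>
  have bounds: "1 - B / real n \<le> Yprob n d (c / real n) (?E n) \<and> Yprob n d (c / real n) (?E n) \<le> 1"
    if n: "n \<ge> max n0 (nat \<lceil>c\<rceil>)" for n
  proof -
    have "c \<le> real n" using n by linarith
    then have p: "0 \<le> c / real n" "c / real n \<le> 1" using c by auto
    have sub: "bad_cores n d \<delta> \<subseteq> Pow (dsimplices n d)" by (auto simp: bad_cores_def)
    have bad: "\<exists>T\<in>bad_cores n d \<delta>. T \<subseteq> S" if "S \<subseteq> dsimplices n d" "\<not> ?E n S" for S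
      using that unfolding bad_cores_def by blast
    show ?thesis
      using Yprob_bounds[where E = "?E n", OF p sub bad] B[of n] n by fastforce
  qed
  have lower: "\<forall>\<^sub>F n in sequentially. 1 - B / real n \<le> Yprob n d (c / real n) (?E n)"
    by (rule eventually_sequentiallyI[of "max n0 (nat \<lceil>c\<rceil>)"]) (rule conjunct1[OF bounds])
  have upper: "\<forall>\<^sub>F n in sequentially. Yprob n d (c / real n) (?E n) \<le> 1"
    by (rule eventually_sequentiallyI[of "max n0 (nat \<lceil>c\<rceil>)"]) (rule conjunct2[OF bounds])
  have "(\<lambda>n. 1 - B / real n) \<longlonglongrightarrow> 1 - 0"
    by (intro tendsto_diff tendsto_const lim_const_over_n)
  then have "(\<lambda>n. 1 - B / real n) \<longlonglongrightarrow> 1" by simp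
  then have "(\<lambda>n. Yprob n d (c / real n) (?E n)) \<longlonglongrightarrow> 1"
    by (rule tendsto_sandwich[OF lower upper _ tendsto_const])
  with \<delta> show "\<exists>\<delta>::real. \<delta> > 0 \<and> (\<lambda>n. Yprob n d (c / real n)
        (\<lambda>S. \<forall>T. T \<subseteq> S \<and> minimal_core d T \<and> real (card T) \<le> \<delta> * real n ^ d
               \<longrightarrow> contains_boundary d T)) \<longlonglongrightarrow> 1"
    by (intro exI[of _ \<delta>] conjI)
qed

end
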